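(* Let $f_1,\dots,f_N$ be the local objectives of $N$ clients on $\mathbb{R}^d$, let $f=\frac1N\sum_{k=1}^N f_k$ be the global objective, and let $\|\cdot\|$ be the Euclidean norm. Write $g_k(w)$ for the stochastic gradient of client $k$ at $w$ and $g_k^{(t)}$ for the stochastic gradient that client $k$ uses at time step $t$. Assume that, for some constants $L>0$, $L_p>0$, $\sigma$, $\epsilon$: (1) the local objectives are smooth: $\|\nabla f_k(w_1)-\nabla f_k(w_2)\|\le L\|w_1-w_2\|$ for all $w_1,w_2,k$; (2) the global objective is Lipschitz: $|f(w_1)-f(w_2)|\le L_p\|w_1-w_2\|$ for all $w_1,w_2$; (3) the clients' stochastic gradients are unbiased: $\mathbb{E}[g_k(w)]=\nabla f_k(w)$ for all $k,w$; (4) the local gradient variance is bounded: $\mathbb{E}\|g_k(w)-\nabla f_k(w)\|^2\le\sigma^2$ for all $k,w$; (5) the clients' gradients do not deviate much from the global one: $\|\nabla f(w)-\nabla f_k(w)\|^2\le\epsilon^2$ for all $k,w$; (6) time independent gradients: $\mathbb{E}\big[g_k^{(t_1)}g_k^{(t_2)}\big]=\mathbb{E}\big[g_k^{(t_1)}\big]\,\mathbb{E}\big[g_k^{(t_2)}\big]$ for all $t_1\ne t_2$; (7) client independent gradients: $\mathbb{E}\big[g_{k_1}^{(t_1)}g_{k_2}^{(t_2)}\big]=\mathbb{E}\big[g_{k_1}^{(t_1)}\big]\,\mathbb{E}\big[g_{k_2}^{(t_2)}\big]$ for all $k_1\ne k_2$ and any $t_1,t_2$. Run the FedSparsify algorithm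 (described in the context) for $T$ federation rounds with $S$ local updates per client per round, with all $N$ clients participating in every round and equally weighted, and with learning rate $\eta<(4\sqrt2\,LS)^{-1}$. Then the parameters $w^{(t)}$ obtained at the end of each federation round and the masks $m^{(t)}$ satisfy $$\frac1T\sum_{t=1}^T\left\|m^{(t)}\odot\nabla f\big(w^{(t)}\big)\right\|^2\le 2\eta L\left[(1+4L\eta S)\sigma^2+(16L\eta S^2)\epsilon^2\right]+\frac{4}{T\eta S}\,\mathbb{E}\left[f\big(w^{(1)}\big)-f\big(w^{( * )}\big)\right]+\frac{4}{T\eta S}\sum_{t=1}^T L_p\left\|w^{(t+1)}-\bar w^{(t+1)}\right\|,$$ where $\bar w^{(t+1)}=\frac1N\sum_{k=1}^N w_k^{(t,S)}$ is the vector of parameters right before sparsification is done in round $t$, and $w^{( * )}$ is the optimal parameter of sparsity $S_T$, with $S_T$ the final desired sparsification of the pruning schedule.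
   Context: Notation. $\odot$ is the entrywise (Hadamard) product; a mask is a vector in $\{0,1\}^d$; $[v]_i$ is the $i$-th entry of $v$. The sparsity of a parameter vector is the fraction of its entries that are zero (pruned). "Optimal" refers to the global objective $f$. FedSparsify trains a model on $N$ clients coordinated by a server, starting from global parameters $w^{(1)}$ and a global mask $m^{(1)}$, by magnitude pruning of the weights in each round. Round $t=1,\dots,T$. Each client $k$ starts from $w_k^{(t,0)}=w^{(t)}$ and performs $S$ masked stochastic gradient steps $$w_k^{(t,i+1)}=w_k^{(t,i)}-\eta\,g_k^{(t,i)}\odot m^{(t)},\qquad i=0,\dots,S-1,$$ where $g_k^{(t,i)}$ is the stochastic gradient of client $k$'s objective at $w_k^{(t,i)}$. With equal client weights the aggregate of the local models is $\bar w^{(t+1)}=\frac1N\sum_{k=1}^N w_k^{(t,S)}$. For a vector $w$ and a fraction $s$, the purging mask of $w$ at level $s$ is the binary mask that is $0$ at the entries of $w$ whose magnitude is in the bottom fraction $s$ and $1$ elsewhere. Then: - FedSparsify-Global: the server sets $m^{(t+1)}$ to be the purging mask of $\bar w^{(t+1)}$ at level $s_t$. - FedSparsify-Local: each client $k$ computes the purging mask $m_k$ of $w_k^{(t,S)}$ at level $s_t$, and the server uses majority voting: $[m^{(t+1)}]_i=1$ if $\sum_{k=1}^N[m_k]_i\ge N/2$, and $[m^{(t+1)}]_i=0$ otherwise. In both variants $w^{(t+1)}=\bar w^{(t+1)}\odot m^{(t+1)}$. Once a parameter is pruned, it never rejoins training. Pruning schedule. The sparsification level at round $t$ is $$s_t=S_T+(S_0-S_T)\left(1-\frac{F\lfloor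 t/F\rfloor-t_0}{T-t_0}\right)^n,$$ where $S_0$ is the initial sparsification, $S_T$ the final desired sparsification, $t_0$ the round at which pruning starts, $F$ the pruning frequency (pruning every $F$ rounds), and $n$ the exponent controlling the rate of sparsification.
   Formalization: Expectation is taken on both sides; (6),(7) are read as mutual independence of the samples over clients and steps (and of w^(1), m^(1)); unless the variant is Global and F divides T, w^(T+1) is assumed to have sparsity at least S_T almost surely, as the bound can fail otherwise. *)

theory Defs
  imports "HOL-Probability.Probability"
begin

definition gradient :: "('a::real_inner \<Rightarrow> real) \<Rightarrow> 'a \<Rightarrow> 'a" where
  "gradient f x = (THE D. GDERIV f x :> D)"

definition client_avg :: "('k::finite \<Rightarrow> 'a::real_vector) \<Rightarrow> 'a" where
  "client_avg u = (1 / real CARD('k)) *\<^sub>R (\<Sum>k\<in>UNIV. u k)"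

definition sparsity :: "real ^ 'd \<Rightarrow> real" where
  "sparsity v = real (card {i. v $ i = 0}) / real CARD('d)"

text \<open>
  A fraction s of the CARD('d) entries need not be a whole number of entries.  The required number
  of zeros is rounded up, as it is by the purging mask below (when there are no ties); if
  s * CARD('d) is an integer, the condition is \<open>sparsity v = s\<close>.
\<close>

definition has_sparsity :: "real \<Rightarrow> real ^ 'd \<Rightarrow> bool" where
  "has_sparsity s v \<longleftrightarrow> sparsity v = of_int \<lceil>s * real CARD('d)\<rceil> / real CARD('d)"

definition optimal_of_sparsity :: "(real ^ 'd \<Rightarrow> real) \<Rightarrow> real \<Rightarrow> real ^ 'd \<Rightarrow> bool" where
  "optimal_of_sparsity f s v \<longleftrightarrow> has_sparsity s v \<and> (\<forall>x. has_sparsity s x \<longrightarrow> f v \<le> f x)"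

text \<open>
  An entry is in the bottom fraction s if the entries of strictly smaller magnitude make up less
  than the fraction s.  Membership depends on the magnitude only, so entries of equal magnitude
  are pruned or kept together.
\<close>

definition purging_mask :: "real \<Rightarrow> real ^ 'd \<Rightarrow> real ^ 'd" where
  "purging_mask s v =
     (\<chi> i. if real (card {j. \<bar>v $ j\<bar> < \<bar>v $ i\<bar>}) < s * real CARD('d) then 0 else 1)"

definition majority_vote :: "('k::finite \<Rightarrow> real ^ 'd) \<Rightarrow> real ^ 'd" where
  "majority_vote \<mu> = (\<chi> i. if (\<Sum>k\<in>UNIV. \<mu> k $ i) \<ge> real CARD('k) / 2 then 1 else 0)"

datatype fed_variant = Sparsify_Global | Sparsify_Local

fun fed_mask :: "fed_variant \<Rightarrow> real \<Rightarrow> ('k::finite \<Rightarrow> real ^ 'd) \<Rightarrow> real ^ 'd" where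
  "fed_mask Sparsify_Global s u = purging_mask s (client_avg u)"
| "fed_mask Sparsify_Local s u = majority_vote (\<lambda>k. purging_mask s (u k))"

definition sparsity_schedule ::
  "real \<Rightarrow> real \<Rightarrow> nat \<Rightarrow> nat \<Rightarrow> nat \<Rightarrow> real \<Rightarrow> nat \<Rightarrow> real" where
  "sparsity_schedule S0 ST F t0 T n t =
     ST + (S0 - ST) *
       (1 - (real F * of_int \<lfloor>real t / real F\<rfloor> - real t0) / (real T - real t0)) powr n"

text \<open>
  One execution of FedSparsify, for fixed outcomes of the stochastic gradients: \<open>g k t i x\<close> is the
  stochastic gradient that client k obtains at x in local step i of round t.  The sequences
  \<open>w t\<close>, \<open>m t\<close> start at t = 1, and \<open>u k t i\<close> is the local model of client k.  The product of vectors
  is the entrywise one.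

  The factor \<open>m t\<close> in the new mask expresses that a pruned parameter never rejoins training.  If
  \<open>s t > 0\<close> and w is zero outside the mask, it is redundant: entries that are zero in all
  local models have the least magnitude and are purged again.
\<close>

definition fedsparsify_run ::
  "fed_variant \<Rightarrow> nat \<Rightarrow> nat \<Rightarrow> (nat \<Rightarrow> real) \<Rightarrow> real
   \<Rightarrow> ('k::finite \<Rightarrow> nat \<Rightarrow> nat \<Rightarrow> real ^ 'd \<Rightarrow> real ^ 'd)
   \<Rightarrow> (nat \<Rightarrow> real ^ 'd) \<Rightarrow> (nat \<Rightarrow> real ^ 'd) \<Rightarrow> ('k \<Rightarrow> nat \<Rightarrow> nat \<Rightarrow> real ^ 'd) \<Rightarrow> bool" where
  "fedsparsify_run variant T S s \<eta> g w m u \<longleftrightarrow>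
     (\<forall>t\<in>{1..T}.
        (\<forall>k. u k t 0 = w t \<and>
             (\<forall>i<S. u k t (Suc i) = u k t i - \<eta> *\<^sub>R (g k t i (u k t i) * m t))) \<and>
        m (Suc t) = m t * fed_mask variant (s t) (\<lambda>k. u k t S) \<and>
        w (Suc t) = client_avg (\<lambda>k. u k t S) * m (Suc t))"

end

(*
  The noise of a local step has mean zero given the past, so averaging the descent inequality of
  the smooth objective f along one round leaves -eta S / 2 times the squared masked gradient, the
  variance of the aggregated noise, and the drift of the local models from the start of the round.
  The step size is small enough for the drift to be paid for by half of the gradient term.  Pruning
  costs L_p times the distance moved, and the sum over the rounds telescopes, down to the value of f
  at parameters of sparsity at least S_T, which f(w_opt) bounds from below since f is continuous.
*)

theory Submission
  imports Defs
begin

section \<open>Gradients\<close>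

text \<open>The obstacle is the constant of sigma^2. The summand 2 eta L sigma^2 of the bound is
  exactly 4 / (eta S) times \<open>L * \<eta>\<^sup>2 / 2\<close> times the variance S sigma^2 of a
  round's noise. So the move of a round, noise N plus summed gradients B, cannot be estimated by ||N
  + B||^2 <= 2 ||N||^2 + 2 ||B||^2, which would double it. The inner product of N and B must be
  handled, and its mean is not zero: a later gradient is taken at a model that earlier noise has
  moved. It is split into a part of mean zero and a remainder of higher order in eta, which is
  charged to the summand 4 L eta S next to the 1. Means of zero come from a filtration: the sample
  of a step is independent of everything before it, for all clients, so the past can be frozen and
  the sample alone integrated out. Masks are random but fixed within a round, and local steps move
  only in the coordinates of the mask; hence it is the masked gradient that the descent controls.
  The bound \<open>L\<^sub>p\<close> has a second use: it makes all gradients bounded, so first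
  moments of the parameters suffice.\<close>

lemma gradient_eqI:
  assumes "GDERIV f x :> D"
  shows "gradient f x = D"
  unfolding gradient_def
proof (rule the_equality)
  fix E assume "GDERIV f x :> E"
  then have "(\<lambda>h. inner h E) = (\<lambda>h. inner h D)"
    using assms unfolding gderiv_def by (rule has_derivative_unique)
  then have "inner (E - D) E = inner (E - D) D"
    by meson
  then have "inner (E - D) (E - D) = 0"
    by (simp only: inner_diff_right)
  then show "E = D"
    by simp
qed (fact assms)

text \<open>\<open>gradient\<close> is a definite description and means something only once a
  representing vector exists; in a Euclidean space the coordinates of the derivative supply it
  (Riesz).\<close>

lemma GDERIV_gradient:
  fixes f :: "'a::euclidean_space \<Rightarrow> real"
  assumes "f differentiable (at x)"
  shows "GDERIV f x :> gradient f x"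
proof -
  obtain f' where f': "(f has_derivative f') (at x)"
    using assms by (auto simp: differentiable_def)
  interpret linear f'
    using f' by (rule has_derivative_linear)
  have "f' = (\<lambda>h. inner h (\<Sum>b\<in>Basis. f' b *\<^sub>R b))"
  proof
    fix h
    have "f' h = f' (\<Sum>b\<in>Basis. inner h b *\<^sub>R b)"
      by (simp add: euclidean_representation)
    also have "\<dots> = inner h (\<Sum>b\<in>Basis. f' b *\<^sub>R b)"
      by (simp add: sum scale inner_sum_right mult.commute)
    finally show "f' h = inner h (\<Sum>b\<in>Basis. f' b *\<^sub>R b)" .
  qed
  with f' have "GDERIV f x :> (\<Sum>b\<in>Basis. f' b *\<^sub>R b)"
    unfolding gderiv_def by (rule back_subst)
  then show ?thesis
    by (simp add: gradient_eqI)
qed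

lemma has_field_derivative_along_line:
  assumes "GDERIV f (x + r *\<^sub>R h) :> D"
  shows "((\<lambda>r. f (x + r *\<^sub>R h)) has_field_derivative inner D h) (at r)"
proof -
  have "((\<lambda>r. x + r *\<^sub>R h) has_derivative (\<lambda>s. s *\<^sub>R h)) (at r)"
    by (auto intro!: derivative_eq_intros)
  from has_derivative_compose[OF this assms[unfolded gderiv_def]] show ?thesis
    by (simp add: has_field_derivative_def inner_commute mult.commute[of _ "inner D h"])
qed

text \<open>Along the segment, f minus the claimed bound has derivative <f'(x + r h) - f'(x), h> - L
  r ||h||^2, which Cauchy-Schwarz and the Lipschitz gradient make nonpositive. Monotonicity of
  \<open>\<phi>\<close> replaces the usual integral of the gradient.\<close>

lemma smooth_descent:
  fixes f :: "'a::real_inner \<Rightarrow> real"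
  assumes deriv: "\<And>x. GDERIV f x :> f' x"
    and lip: "\<And>x y. norm (f' x - f' y) \<le> L * norm (x - y)"
  shows "f y \<le> f x + inner (f' x) (y - x) + L / 2 * (norm (y - x))\<^sup>2"
proof -
  define h where "h = y - x"
  define \<phi> where
    "\<phi> r = f (x + r *\<^sub>R h) - r * inner (f' x) h - L / 2 * (norm h)\<^sup>2 * r\<^sup>2" for r
  have "\<phi> 1 \<le> \<phi> 0"
  proof (rule DERIV_nonpos_imp_nonincreasing[where f = \<phi>])
    fix r :: real assume r: "0 \<le> r" "r \<le> 1"
    have "((\<lambda>r. f (x + r *\<^sub>R h)) has_field_derivative inner (f' (x + r *\<^sub>R h)) h) (at r)"
      by (intro has_field_derivative_along_line deriv)
    then have der: "(\<phi> has_field_derivative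
        inner (f' (x + r *\<^sub>R h)) h - inner (f' x) h - L / 2 * (norm h)\<^sup>2 * (2 * r)) (at r)"
      unfolding \<phi>_def by (auto intro!: derivative_eq_intros)
    have "inner (f' (x + r *\<^sub>R h) - f' x) h \<le> norm (f' (x + r *\<^sub>R h) - f' x) * norm h"
      by (rule norm_cauchy_schwarz)
    also have "\<dots> \<le> L * norm (r *\<^sub>R h) * norm h"
      using lip[of "x + r *\<^sub>R h" x] by (intro mult_right_mono) auto
    also have "\<dots> = L / 2 * (norm h)\<^sup>2 * (2 * r)"
      using r by (simp add: power2_eq_square)
    finally show "\<exists>d. (\<phi> has_field_derivative d) (at r) \<and> d \<le> 0"
      using der by (intro exI[of _ "inner (f' (x + r *\<^sub>R h)) h - inner (f' x) h - L / 2 * (norm h)\<^sup>2 * (2 * r)"])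
        (auto simp: inner_diff_left)
  qed simp
  then show ?thesis
    by (simp add: \<phi>_def h_def)
qed

text \<open>The difference quotient in the direction of the gradient itself tends to the squared
  norm of the gradient and is at most C times that norm. Bounded gradients are what later makes
  drifts square integrable.\<close>

lemma norm_gradient_le:
  fixes f :: "'a::euclidean_space \<Rightarrow> real"
  assumes "f differentiable (at x)" and lip: "\<And>x y. \<bar>f x - f y\<bar> \<le> C * norm (x - y)"
  shows "norm (gradient f x) \<le> C"
proof -
  define g where "g = gradient f x"
  have "((\<lambda>r. f (x + r *\<^sub>R g)) has_field_derivative inner g g) (at 0)"
    using GDERIV_gradient[OF assms(1)]
    by (intro has_field_derivative_along_line) (simp add: g_def)
  then have lim: "((\<lambda>r. (f (x + r *\<^sub>R g) - f x) / r) \<longlongrightarrow> (norm g)\<^sup>2) (at 0)"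
    by (simp add: DERIV_def power2_norm_eq_inner)
  have "(f (x + r *\<^sub>R g) - f x) / r \<le> C * norm g" if "r \<noteq> 0" for r
  proof -
    have "(f (x + r *\<^sub>R g) - f x) / r \<le> \<bar>f (x + r *\<^sub>R g) - f x\<bar> / \<bar>r\<bar>"
      by (metis abs_divide abs_ge_self)
    also have "\<dots> \<le> (C * norm (r *\<^sub>R g)) / \<bar>r\<bar>"
      using lip[of "x + r *\<^sub>R g" x] by (intro divide_right_mono) auto
    also have "\<dots> = C * norm g"
      using that by simp
    finally show ?thesis .
  qed
  then have "(norm g)\<^sup>2 \<le> C * norm g"
    by (intro tendsto_upperbound[OF lim] eventually_mono[OF eventually_neq_at_within]) auto
  \<comment> \<open>This settles the case of a vanishing gradient, where nothing can be cancelled; a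
    Euclidean space has at least one basis vector to test with.\<close>
  moreover have "0 \<le> C"
  proof -
    obtain b :: 'a where b: "b \<in> Basis"
      using nonempty_Basis by blast
    then show ?thesis
      using lip[of b 0] by simp
  qed
  ultimately show ?thesis
    by (cases "g = 0") (auto simp: power2_eq_square g_def)
qed

section \<open>Averages and drift in one round\<close>

lemma client_avg_add: "client_avg (\<lambda>k. u k + v k) = client_avg u + client_avg v"
  by (simp add: client_avg_def sum.distrib scaleR_add_right)

lemma client_avg_diff: "client_avg (\<lambda>k. u k - v k) = client_avg u - client_avg v"
  by (simp add: client_avg_def sum_subtractf scaleR_diff_right)

lemma client_avg_const [simp]: "client_avg (\<lambda>k::'k::finite. c) = c"
  by (simp add: client_avg_def sum_constant_scaleR)

lemma client_avg_scaleR: "client_avg (\<lambda>k. c *\<^sub>R u k) = c *\<^sub>R client_avg u"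
  by (simp add: client_avg_def flip: scaleR_sum_right)

lemma client_avg_mult: "client_avg (\<lambda>k. c * u k) = c * client_avg u" for c :: real
  using client_avg_scaleR[of c u] by simp

lemma client_avg_sum: "client_avg (\<lambda>k. \<Sum>i\<in>A. u k i) = (\<Sum>i\<in>A. client_avg (\<lambda>k. u k i))"
  unfolding client_avg_def by (subst sum.swap) (simp add: scaleR_sum_right)

lemma client_avg_inner: "inner x (client_avg u) = client_avg (\<lambda>k. inner x (u k))"
  by (simp add: client_avg_def inner_sum_right)

lemma client_avg_mono:
  fixes u v :: "'k::finite \<Rightarrow> real"
  assumes "\<And>k. u k \<le> v k"
  shows "client_avg u \<le> client_avg v"
  unfolding client_avg_def using assms by (intro scaleR_left_mono sum_mono) auto

text \<open>Bias-variance decomposition over the clients. Besides Jensen's inequality it yields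
  ||a||^2 + eps^2, with no factor 2, for the mean squared client gradient.\<close>

lemma client_avg_norm_sq:
  fixes u :: "'k::finite \<Rightarrow> 'a::real_inner"
  shows "client_avg (\<lambda>k. (norm (u k))\<^sup>2)
    = (norm (client_avg u))\<^sup>2 + client_avg (\<lambda>k. (norm (u k - client_avg u))\<^sup>2)"
proof -
  have "(norm (u k - client_avg u))\<^sup>2
      = (norm (u k))\<^sup>2 - 2 * inner (client_avg u) (u k) + (norm (client_avg u))\<^sup>2" for k
    by (simp add: power2_norm_eq_inner inner_diff_left inner_diff_right inner_commute)
  then show ?thesis
    by (simp add: client_avg_add client_avg_diff client_avg_mult power2_norm_eq_inner
        flip: client_avg_inner)
qed

lemma norm_client_avg_sq_le:
  fixes u :: "'k::finite \<Rightarrow> 'a::real_inner"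
  shows "(norm (client_avg u))\<^sup>2 \<le> client_avg (\<lambda>k. (norm (u k))\<^sup>2)"
proof -
  have "client_avg (\<lambda>k::'k. 0) \<le> client_avg (\<lambda>k. (norm (u k - client_avg u))\<^sup>2)"
    by (rule client_avg_mono) simp
  then show ?thesis
    using client_avg_norm_sq[of u] by simp
qed

lemma norm_sum_sq_le:
  "(norm (\<Sum>i<n. x i :: 'a::real_inner))\<^sup>2 \<le> real n * (\<Sum>i<n. (norm (x i))\<^sup>2)"
proof -
  have "(norm (\<Sum>i<n. x i))\<^sup>2 \<le> (\<Sum>i<n. norm (x i))\<^sup>2"
    by (intro power_mono norm_sum) simp
  also have "\<dots> \<le> real n * (\<Sum>i<n. (norm (x i))\<^sup>2)"
    using sum_squared_le_sum_of_squares[of "\<lambda>i. norm (x i)" "{..<n}"] by (simp add: mult.commute)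
  finally show ?thesis .
qed

lemma norm_sum3_sq_le:
  "(norm (x + y + z))\<^sup>2 \<le> 3 * ((norm x)\<^sup>2 + (norm y)\<^sup>2 + (norm (z :: 'a::real_inner))\<^sup>2)"
proof -
  have "0 \<le> (norm (x - y))\<^sup>2 + (norm (y - z))\<^sup>2 + (norm (x - z))\<^sup>2"
    by simp
  then show ?thesis
    by (simp add: power2_norm_eq_inner inner_diff_left inner_diff_right inner_add_left
        inner_add_right inner_commute algebra_simps)
qed

section \<open>Small steps: local drift and pathwise descent of one round\<close>

lemma step_size_sq:
  fixes L \<eta> :: real
  assumes "L > 0" "\<eta> > 0" "S > 0" "\<eta> < 1 / (4 * sqrt 2 * L * real S)"
  shows "32 * (\<eta> * L * real S)\<^sup>2 \<le> 1"
proof -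
  have "\<eta> * L * real S * (4 * sqrt 2) \<le> 1"
    using assms by (simp add: field_simps)
  then have "(\<eta> * L * real S * (4 * sqrt 2))\<^sup>2 \<le> 1\<^sup>2"
    using assms by (intro power_mono) auto
  then show ?thesis
    by (simp add: power_mult_distrib)
qed

text \<open>The total drift V is bounded in terms of itself: a displacement consists of noise, of
  changes of the gradient since the start (at most L times earlier drift), and of i copies of the
  first gradient. The middle part contributes 3/2 (eta L S)^2 V <= 3/64 V, which is absorbed on the
  left and leaves 1 - 3/64 = 61/64.\<close>

lemma local_drift:
  fixes n h u :: "nat \<Rightarrow> 'a::real_inner"
  assumes small: "32 * (\<eta> * L * real S)\<^sup>2 \<le> 1"
    and u: "\<And>i. i < S \<Longrightarrow> u i = x - \<eta> *\<^sub>R (\<Sum>j<i. n j + h j)"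
    and lip: "\<And>i. i < S \<Longrightarrow> norm (h i - h 0) \<le> L * norm (u i - x)"
  shows "61 * (\<Sum>i<S. (norm (u i - x))\<^sup>2)
    \<le> 64 * (3 * \<eta>\<^sup>2 * (\<Sum>i<S. (norm (\<Sum>j<i. n j))\<^sup>2) + \<eta>\<^sup>2 * real S ^ 3 * (norm (h 0))\<^sup>2)"
proof -
  define V where "V = (\<Sum>i<S. (norm (u i - x))\<^sup>2)"
  have V: "0 \<le> V" by (simp add: V_def sum_nonneg)
  have step: "(norm (u i - x))\<^sup>2 \<le> 3 * \<eta>\<^sup>2 * (norm (\<Sum>j<i. n j))\<^sup>2
      + 3 * \<eta>\<^sup>2 * L\<^sup>2 * V * real i + 3 * \<eta>\<^sup>2 * (norm (h 0))\<^sup>2 * (real i)\<^sup>2" if i: "i < S" for i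
  proof -
    define R where "R = (\<Sum>j<i. n j) + (\<Sum>j<i. h j - h 0) + real i *\<^sub>R h 0"
    have "R = (\<Sum>j<i. n j + h j)"
      by (simp add: R_def sum.distrib sum_subtractf sum_constant_scaleR)
    then have "(norm (u i - x))\<^sup>2 = \<eta>\<^sup>2 * (norm R)\<^sup>2"
      using i by (simp add: u power_mult_distrib)
    also have "\<dots> \<le> \<eta>\<^sup>2 * (3 * ((norm (\<Sum>j<i. n j))\<^sup>2
        + (norm (\<Sum>j<i. h j - h 0))\<^sup>2 + (norm (real i *\<^sub>R h 0))\<^sup>2))"
      unfolding R_def by (intro mult_left_mono norm_sum3_sq_le) simp
    finally have R: "(norm (u i - x))\<^sup>2 \<le> \<eta>\<^sup>2 * (3 * ((norm (\<Sum>j<i. n j))\<^sup>2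
        + (norm (\<Sum>j<i. h j - h 0))\<^sup>2 + (norm (real i *\<^sub>R h 0))\<^sup>2))" .
    have "(norm (\<Sum>j<i. h j - h 0))\<^sup>2 \<le> real i * (\<Sum>j<i. (norm (h j - h 0))\<^sup>2)"
      by (rule norm_sum_sq_le)
    also have "\<dots> \<le> real i * (\<Sum>j<i. L\<^sup>2 * (norm (u j - x))\<^sup>2)"
      using i lip by (intro mult_left_mono sum_mono)
        (auto simp flip: power_mult_distrib intro!: power_mono)
    also have "\<dots> \<le> real i * (L\<^sup>2 * V)"
      unfolding V_def sum_distrib_left[symmetric] using i
      by (intro mult_left_mono sum_mono2) auto
    finally have "\<eta>\<^sup>2 * (3 * ((norm (\<Sum>j<i. n j))\<^sup>2
        + (norm (\<Sum>j<i. h j - h 0))\<^sup>2 + (norm (real i *\<^sub>R h 0))\<^sup>2))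
      \<le> \<eta>\<^sup>2 * (3 * ((norm (\<Sum>j<i. n j))\<^sup>2 + real i * (L\<^sup>2 * V) + (norm (real i *\<^sub>R h 0))\<^sup>2))"
      by (intro mult_left_mono add_mono) auto
    with R have "(norm (u i - x))\<^sup>2
      \<le> \<eta>\<^sup>2 * (3 * ((norm (\<Sum>j<i. n j))\<^sup>2 + real i * (L\<^sup>2 * V) + (norm (real i *\<^sub>R h 0))\<^sup>2))"
      by (rule order_trans)
    then show ?thesis
      by (simp add: power_mult_distrib algebra_simps)
  qed
  have sum1: "2 * (\<Sum>i<k. real i) \<le> (real k)\<^sup>2" for k
    by (induction k) (auto simp: power2_eq_square algebra_simps)
  have sum2: "3 * (\<Sum>i<k. (real i)\<^sup>2) \<le> real k ^ 3" for k
    by (induction k) (auto simp: power2_eq_square power3_eq_cube algebra_simps)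
  define P where "P = (\<Sum>i<S. (norm (\<Sum>j<i. n j))\<^sup>2)"
  have "V \<le> (\<Sum>i<S. 3 * \<eta>\<^sup>2 * (norm (\<Sum>j<i. n j))\<^sup>2
      + 3 * \<eta>\<^sup>2 * L\<^sup>2 * V * real i + 3 * \<eta>\<^sup>2 * (norm (h 0))\<^sup>2 * (real i)\<^sup>2)"
    unfolding V_def by (intro sum_mono step[unfolded V_def]) auto
  also have "\<dots> = 3 * \<eta>\<^sup>2 * P + 3 / 2 * \<eta>\<^sup>2 * L\<^sup>2 * V * (2 * (\<Sum>i<S. real i))
      + \<eta>\<^sup>2 * (norm (h 0))\<^sup>2 * (3 * (\<Sum>i<S. (real i)\<^sup>2))"
    by (simp add: sum.distrib sum_distrib_left P_def mult_ac)
  also have "\<dots> \<le> 3 * \<eta>\<^sup>2 * P + 3 / 2 * \<eta>\<^sup>2 * L\<^sup>2 * V * (real S)\<^sup>2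
      + \<eta>\<^sup>2 * (norm (h 0))\<^sup>2 * real S ^ 3"
    using V by (intro add_mono mult_left_mono sum1 sum2) auto
  also have "3 / 2 * \<eta>\<^sup>2 * L\<^sup>2 * V * (real S)\<^sup>2 = 3 / 64 * V * (32 * (\<eta> * L * real S)\<^sup>2)"
    by (simp add: power_mult_distrib)
  also have "\<dots> \<le> 3 / 64 * V * 1"
    using V small by (intro mult_left_mono) auto
  finally show ?thesis
    by (simp add: V_def[symmetric] P_def[symmetric] algebra_simps)
qed

text \<open>Young's inequality, by expanding the square of c x - y.\<close>

lemma inner_le_weighted:
  fixes x y :: "'a::real_inner"
  assumes "c > 0"
  shows "inner x y \<le> c / 2 * (norm x)\<^sup>2 + (norm y)\<^sup>2 / (2 * c)"
proof -
  have "0 \<le> (norm (c *\<^sub>R x - y))\<^sup>2"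
    by simp
  also have "\<dots> = c\<^sup>2 * (norm x)\<^sup>2 - 2 * c * inner x y + (norm y)\<^sup>2"
    by (simp add: power2_norm_eq_inner inner_diff_left inner_diff_right inner_commute
        power2_eq_square[of c] algebra_simps)
  finally show ?thesis
    using assms by (simp add: field_simps power2_eq_square)
qed

text \<open>
  The noise \<open>n\<close> is not orthogonal to the later drifts \<open>b j\<close>.  Replacing \<open>b j\<close> by \<open>a\<close> for the noise
  of steps before \<open>j\<close> leaves inner products with predictable vectors, which have mean zero, at the
  cost of \<open>b j - a\<close>, which is bounded by the local drift.
\<close>

lemma round_descent:
  fixes n h u :: "'k::finite \<Rightarrow> nat \<Rightarrow> 'a::real_inner" and y y' :: real
  assumes pos: "L > 0" "\<eta> > 0" "S > 0"
    and small: "32 * (\<eta> * L * real S)\<^sup>2 \<le> 1"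
    and u: "\<And>k i. i \<le> S \<Longrightarrow> u k i = x - \<eta> *\<^sub>R (\<Sum>j<i. n k j + h k j)"
    and lip: "\<And>k i. i < S \<Longrightarrow> norm (h k i - h k 0) \<le> L * norm (u k i - x)"
    and a: "client_avg (\<lambda>k. h k 0) = a"
    and dev: "\<And>k. (norm (h k 0 - a))\<^sup>2 \<le> \<epsilon>\<^sup>2"
    and descent: "y' \<le> y + inner g (client_avg (\<lambda>k. u k S) - x)
        + L / 2 * (norm (client_avg (\<lambda>k. u k S) - x))\<^sup>2"
    and g: "\<And>k i. i < S \<Longrightarrow> inner g (n k i) = inner a (n k i)"
      "\<And>k i. i < S \<Longrightarrow> inner g (h k i) = inner a (h k i)"
  defines "b \<equiv> \<lambda>j. client_avg (\<lambda>k. h k j)"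
    and "Q \<equiv> \<lambda>i. client_avg (\<lambda>k. (norm (\<Sum>j<i. n k j))\<^sup>2)"
  shows "y' \<le> y - \<eta> * real S / 4 * (norm a)\<^sup>2 + 4 * L\<^sup>2 * \<eta> ^ 3 * (\<Sum>i<S. Q i)
    + L * \<eta>\<^sup>2 / 2 * Q S + 8 * \<eta> ^ 3 * L\<^sup>2 * real S ^ 3 * \<epsilon>\<^sup>2
    + (\<Sum>i<S. inner (client_avg (\<lambda>k. n k i))
        ((L * \<eta>\<^sup>2) *\<^sub>R (\<Sum>j<S. if j \<le> i then b j else a) - \<eta> *\<^sub>R a))"
proof -
  define nn where "nn i = client_avg (\<lambda>k. n k i)" for i
  define N where "N i = (\<Sum>j<i. nn j)" for i
  define B where "B = (\<Sum>j<S. b j)"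
  define v where "v j = client_avg (\<lambda>k. (norm (u k j - x))\<^sup>2)" for j
  define W where "W j = inner (N S - N j) (b j) + inner (N j) a" for j
  define A where "A = (norm a)\<^sup>2"
  define SB where "SB = (\<Sum>j<S. (norm (b j))\<^sup>2)"
  define SQ where "SQ = (\<Sum>i<S. Q i)"
  define V where "V = (\<Sum>j<S. v j)"
  have nonneg: "0 \<le> A" "0 \<le> SB"
    by (auto simp: A_def SB_def sum_nonneg)
  have NQ: "(norm (N i))\<^sup>2 \<le> Q i" for i
  proof -
    have "N i = client_avg (\<lambda>k. \<Sum>j<i. n k j)"
      by (simp add: N_def nn_def client_avg_sum)
    then show ?thesis
      unfolding Q_def using norm_client_avg_sq_le by metis
  qed
  have Q_nonneg: "0 \<le> Q i" for i
    using NQ[of i] by (meson order_trans zero_le_power2)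
  then have SQ: "0 \<le> SQ"
    by (simp add: SQ_def sum_nonneg)
  have ba: "(norm (b j - a))\<^sup>2 \<le> L\<^sup>2 * v j" if "j < S" for j
  proof -
    have "(norm (b j - a))\<^sup>2 \<le> client_avg (\<lambda>k. (norm (h k j - h k 0))\<^sup>2)"
      unfolding b_def a[symmetric] client_avg_diff[symmetric] by (rule norm_client_avg_sq_le)
    also have "\<dots> \<le> client_avg (\<lambda>k. L\<^sup>2 * (norm (u k j - x))\<^sup>2)"
      using lip[OF that] by (intro client_avg_mono)
        (auto simp flip: power_mult_distrib intro!: power_mono)
    finally show ?thesis
      by (simp add: v_def client_avg_mult)
  qed
  have move: "client_avg (\<lambda>k. u k S) - x = - (\<eta> *\<^sub>R (N S + B))"
  proof -
    have "client_avg (\<lambda>k. u k S) = client_avg (\<lambda>k. x - \<eta> *\<^sub>R (\<Sum>j<S. n k j + h k j))"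
      by (simp add: u)
    also have "\<dots> = x - \<eta> *\<^sub>R (N S + B)"
      by (simp add: client_avg_diff client_avg_scaleR client_avg_sum client_avg_add sum.distrib
          N_def nn_def B_def b_def)
    finally show ?thesis
      by simp
  qed
  \<comment> \<open>Noise and drift lie in the coordinates of the mask, where the full gradient
    \<open>g\<close> and its masked version \<open>a\<close> act alike.\<close>
  have "inner g (N S + B) = inner a (N S + B)"
    by (simp add: N_def nn_def B_def b_def inner_add_right inner_sum_right client_avg_inner g)
  then have d1: "y' \<le> y - \<eta> * inner a (N S) - \<eta> * inner a B
      + L * \<eta>\<^sup>2 / 2 * (norm (N S + B))\<^sup>2"
    using descent unfolding move norm_minus_cancel inner_minus_right inner_scaleR_right
    by (simp add: power_mult_distrib inner_add_right distrib_left)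
  \<comment> \<open>The polarization identity is kept exact because its term ||b_j||^2 pays for
    ||B||^2 <= S * \<open>SB\<close> in the quadratic part, by eta L S <= 1.\<close>
  have "2 * inner a (b j) = A + (norm (b j))\<^sup>2 - (norm (b j - a))\<^sup>2" for j
    by (simp add: A_def power2_norm_eq_inner inner_diff_left inner_diff_right inner_commute)
  then have "2 * inner a (b j) \<ge> A + (norm (b j))\<^sup>2 - L\<^sup>2 * v j" if "j < S" for j
    using ba[OF that] by simp
  then have "(\<Sum>j<S. 2 * inner a (b j)) \<ge> (\<Sum>j<S. A + (norm (b j))\<^sup>2 - L\<^sup>2 * v j)"
    by (intro sum_mono) auto
  then have "2 * inner a B \<ge> real S * A + SB - L\<^sup>2 * V"
    by (simp add: B_def SB_def V_def inner_sum_right sum_distrib_left sum.distrib sum_subtractf)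
  then have d2: "\<eta> * inner a B \<ge> \<eta> / 2 * (real S * A + SB - L\<^sup>2 * V)"
    using pos by simp
  have "inner (N S) (b j) \<le> W j + 2 * L * \<eta> * Q j + L / (8 * \<eta>) * v j" if "j < S" for j
  proof -
    \<comment> \<open>The weight 4 L eta leaves 2 L eta on \<open>Q j\<close>. Multiplied by
      \<open>L * \<eta>\<^sup>2\<close> this is half of the allowed 4 L^2 eta^3; the other half is
      reserved for the noise contained in the drift.\<close>
    have "inner (N j) (b j - a)
        \<le> 4 * L * \<eta> / 2 * (norm (N j))\<^sup>2 + (norm (b j - a))\<^sup>2 / (2 * (4 * L * \<eta>))"
      using pos by (intro inner_le_weighted) auto
    also have "\<dots> \<le> 4 * L * \<eta> / 2 * Q j + L\<^sup>2 * v j / (2 * (4 * L * \<eta>))"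
      using pos by (intro add_mono mult_left_mono divide_right_mono NQ ba that) auto
    also have "\<dots> = 2 * L * \<eta> * Q j + L / (8 * \<eta>) * v j"
      using pos by (simp add: field_simps power2_eq_square)
    finally show ?thesis
      by (simp add: W_def inner_diff_left inner_diff_right)
  qed
  then have "(\<Sum>j<S. inner (N S) (b j)) \<le> (\<Sum>j<S. W j + 2 * L * \<eta> * Q j + L / (8 * \<eta>) * v j)"
    by (intro sum_mono) auto
  then have NB: "inner (N S) B \<le> (\<Sum>j<S. W j) + 2 * L * \<eta> * SQ + L / (8 * \<eta>) * V"
    by (simp add: B_def SQ_def V_def inner_sum_right sum.distrib sum_distrib_left)
  have "(norm B)\<^sup>2 \<le> real S * SB"
    unfolding B_def SB_def by (rule norm_sum_sq_le)
  with NB NQ[of S] have "(norm (N S + B))\<^sup>2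
      \<le> Q S + 2 * ((\<Sum>j<S. W j) + 2 * L * \<eta> * SQ + L / (8 * \<eta>) * V) + real S * SB"
    by (simp add: power2_norm_eq_inner inner_add_left inner_add_right inner_commute)
  then have "L * \<eta>\<^sup>2 / 2 * (norm (N S + B))\<^sup>2 \<le> L * \<eta>\<^sup>2 / 2 *
      (Q S + 2 * ((\<Sum>j<S. W j) + 2 * L * \<eta> * SQ + L / (8 * \<eta>) * V) + real S * SB)"
    using pos by (intro mult_left_mono) auto
  also have "\<dots> = L * \<eta>\<^sup>2 / 2 * Q S + L * \<eta>\<^sup>2 * (\<Sum>j<S. W j) + 2 * L\<^sup>2 * \<eta> ^ 3 * SQ
      + \<eta> * L\<^sup>2 / 8 * V + \<eta> / 2 * (\<eta> * L * real S) * SB"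
    using pos by (simp add: field_simps power2_eq_square power3_eq_cube)
  also have "\<eta> / 2 * (\<eta> * L * real S) * SB \<le> \<eta> / 2 * 1 * SB"
  proof -
    have "(\<eta> * L * real S)\<^sup>2 \<le> 1\<^sup>2"
      using small by simp
    then have "\<eta> * L * real S \<le> 1"
      by (rule power2_le_imp_le) simp
    then show ?thesis
      using pos nonneg by (intro mult_right_mono mult_left_mono) auto
  qed
  finally have d3: "L * \<eta>\<^sup>2 / 2 * (norm (N S + B))\<^sup>2 \<le> L * \<eta>\<^sup>2 / 2 * Q S
      + L * \<eta>\<^sup>2 * (\<Sum>j<S. W j) + 2 * L\<^sup>2 * \<eta> ^ 3 * SQ + \<eta> * L\<^sup>2 / 8 * V + \<eta> / 2 * SB"
    by simp
  have "client_avg (\<lambda>k. 61 * (\<Sum>i<S. (norm (u k i - x))\<^sup>2))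
      \<le> client_avg (\<lambda>k. 64 * (3 * \<eta>\<^sup>2 * (\<Sum>i<S. (norm (\<Sum>j<i. n k j))\<^sup>2)
          + \<eta>\<^sup>2 * real S ^ 3 * (norm (h k 0))\<^sup>2))"
    using u lip by (intro client_avg_mono local_drift[OF small]) auto
  then have V1: "61 * V \<le> 64 * (3 * \<eta>\<^sup>2 * SQ
      + \<eta>\<^sup>2 * real S ^ 3 * client_avg (\<lambda>k. (norm (h k 0))\<^sup>2))"
    by (simp add: client_avg_mult client_avg_sum client_avg_add V_def v_def SQ_def Q_def)
  have "client_avg (\<lambda>k. (norm (h k 0))\<^sup>2) \<le> A + \<epsilon>\<^sup>2"
  proof -
    have "client_avg (\<lambda>k. (norm (h k 0 - a))\<^sup>2) \<le> client_avg (\<lambda>k::'k. \<epsilon>\<^sup>2)"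
      by (intro client_avg_mono dev)
    then show ?thesis
      using client_avg_norm_sq[of "\<lambda>k. h k 0"] by (simp add: a A_def)
  qed
  then have "\<eta>\<^sup>2 * real S ^ 3 * client_avg (\<lambda>k. (norm (h k 0))\<^sup>2) \<le> \<eta>\<^sup>2 * real S ^ 3 * (A + \<epsilon>\<^sup>2)"
    by (intro mult_left_mono) auto
  with V1 have "61 * V \<le> 64 * (3 * \<eta>\<^sup>2 * SQ + \<eta>\<^sup>2 * real S ^ 3 * (A + \<epsilon>\<^sup>2))"
    by simp
  \<comment> \<open>\<open>V\<close> has the coefficient 5/8 eta L^2 in total, 1/2 from
    \<open>d2\<close> and 1/8 from \<open>d3\<close>, and 5/488 = (5/8) / 61. Afterwards 120/61 <=
    2, and 40/61 (eta L S)^2 is well below 1/4.\<close>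
  then have "5 / 488 * \<eta> * L\<^sup>2 * (61 * V)
      \<le> 5 / 488 * \<eta> * L\<^sup>2 * (64 * (3 * \<eta>\<^sup>2 * SQ + \<eta>\<^sup>2 * real S ^ 3 * (A + \<epsilon>\<^sup>2)))"
    using pos by (intro mult_left_mono) auto
  also have "\<dots> = 120 / 61 * (L\<^sup>2 * \<eta> ^ 3 * SQ) + 40 / 61 * (\<eta> ^ 3 * L\<^sup>2 * real S ^ 3 * \<epsilon>\<^sup>2)
      + 40 / 61 * (\<eta> * L * real S)\<^sup>2 * (\<eta> * real S * A)"
    by (simp add: field_simps power2_eq_square power3_eq_cube)
  also have "\<dots> \<le> 2 * (L\<^sup>2 * \<eta> ^ 3 * SQ) + 8 * (\<eta> ^ 3 * L\<^sup>2 * real S ^ 3 * \<epsilon>\<^sup>2)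
      + 1 / 4 * (\<eta> * real S * A)"
    using small pos nonneg SQ by (intro add_mono mult_right_mono) auto
  finally have d4: "5 / 8 * \<eta> * L\<^sup>2 * V \<le> 2 * L\<^sup>2 * \<eta> ^ 3 * SQ
      + 8 * \<eta> ^ 3 * L\<^sup>2 * real S ^ 3 * \<epsilon>\<^sup>2 + \<eta> * real S / 4 * A"
    by (simp add: algebra_simps)
  \<comment> \<open>Regrouping by the noise step i: its partner contains \<open>b j\<close> only for
    j <= i, and these are determined before sample i is drawn.\<close>
  have "W j = (\<Sum>i<S. inner (nn i) (if j \<le> i then b j else a))" if "j < S" for j
  proof -
    have "(\<Sum>i<S. inner (nn i) (if j \<le> i then b j else a))
        = (\<Sum>i<j. inner (nn i) (if j \<le> i then b j else a))
          + (\<Sum>i=j..<S. inner (nn i) (if j \<le> i then b j else a))"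
      unfolding lessThan_atLeast0 by (rule sum.atLeastLessThan_concat[symmetric]) (use that in auto)
    also have "\<dots> = inner (N j) a + inner (\<Sum>i=j..<S. nn i) (b j)"
      by (simp add: N_def inner_sum_left)
    also have "(\<Sum>i=j..<S. nn i) = N S - N j"
      using that sum.atLeastLessThan_concat[of 0 j S nn]
      by (simp add: N_def lessThan_atLeast0 algebra_simps)
    finally show ?thesis
      by (simp add: W_def)
  qed
  then have "(\<Sum>j<S. W j) = (\<Sum>j<S. \<Sum>i<S. inner (nn i) (if j \<le> i then b j else a))"
    by simp
  then have sumW: "(\<Sum>j<S. W j) = (\<Sum>i<S. inner (nn i) (\<Sum>j<S. if j \<le> i then b j else a))"
    by (subst (asm) sum.swap) (simp add: inner_sum_right)
  have "(\<Sum>i<S. inner (nn i) ((L * \<eta>\<^sup>2) *\<^sub>R (\<Sum>j<S. if j \<le> i then b j else a) - \<eta> *\<^sub>R a))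
      = L * \<eta>\<^sup>2 * (\<Sum>j<S. W j) - \<eta> * inner a (N S)"
    unfolding sumW inner_diff_right inner_scaleR_right sum_subtractf
    by (simp add: N_def inner_sum_right inner_commute sum_distrib_left)
  then show ?thesis
    using d1 d2 d3 d4 unfolding nn_def[symmetric] SQ_def[symmetric] A_def[symmetric]
    by (simp add: algebra_simps)
qed

section \<open>Sparsity and pruning\<close>

text \<open>Take a kept entry of least magnitude. Everything strictly smaller is purged, and that
  the entry is kept says that these entries already make up the fraction s. If no entry is kept, all
  CARD('d) of them are zeros and s <= 1 is enough.\<close>

lemma sparsity_purging_mask:
  fixes v :: "real ^ 'd"
  assumes "s \<le> 1"
  shows "s * real CARD('d) \<le> real (card {i. purging_mask s v $ i = 0})"
proof -
  define Z where "Z = {i. real (card {j. \<bar>v $ j\<bar> < \<bar>v $ i\<bar>}) < s * real CARD('d)}"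
  have "{i. purging_mask s v $ i = 0} = Z"
    by (auto simp: purging_mask_def Z_def)
  moreover have "s * real CARD('d) \<le> real (card Z)"
  proof (cases "Z = UNIV")
    case True
    then show ?thesis
      using mult_right_mono[OF assms, of "real CARD('d)"] by simp
  next
    case False
    then have "Min ((\<lambda>i. \<bar>v $ i\<bar>) ` (- Z)) \<in> (\<lambda>i. \<bar>v $ i\<bar>) ` (- Z)"
      by (intro Min_in) auto
    then obtain i where i: "i \<notin> Z" "\<bar>v $ i\<bar> = Min ((\<lambda>i. \<bar>v $ i\<bar>) ` (- Z))"
      by auto
    have "{j. \<bar>v $ j\<bar> < \<bar>v $ i\<bar>} \<subseteq> Z"
    proof (rule subsetI, rule ccontr)
      fix j assume "j \<in> {j. \<bar>v $ j\<bar> < \<bar>v $ i\<bar>}" "j \<notin> Z"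
      moreover from this have "Min ((\<lambda>i. \<bar>v $ i\<bar>) ` (- Z)) \<le> \<bar>v $ j\<bar>"
        by (intro Min_le) auto
      ultimately show False
        using i by simp
    qed
    then have "card {j. \<bar>v $ j\<bar> < \<bar>v $ i\<bar>} \<le> card Z"
      by (intro card_mono) auto
    then show ?thesis
      using i(1) unfolding Z_def mem_Collect_eq not_less by linarith
  qed
  ultimately show ?thesis
    by simp
qed

text \<open>The mere existence of a vector of sparsity s limits s, as it cannot have more zeros than
  entries. In this way the optimal parameter supplies the bound on the level that purging
  requires.\<close>

lemma has_sparsity_le_1:
  fixes v :: "real ^ 'd"
  assumes "has_sparsity s v"
  shows "s \<le> 1"
proof -
  have "of_int \<lceil>s * real CARD('d)\<rceil> = real (card {i. v $ i = 0})"
    using assms by (simp add: has_sparsity_def sparsity_def)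
  moreover have "real (card {i. v $ i = 0}) \<le> real CARD('d)"
    by (intro of_nat_mono card_mono) auto
  moreover have "s * real CARD('d) \<le> of_int \<lceil>s * real CARD('d)\<rceil>"
    by (rule le_of_int_ceiling)
  ultimately have "s * real CARD('d) \<le> 1 * real CARD('d)"
    by linarith
  then show ?thesis
    by (rule mult_right_le_imp_le) simp
qed

text \<open>
  Every \<open>v\<close> with at least the required number of zeros is a limit of vectors with exactly that
  number of zeros.
\<close>

lemma optimal_of_sparsity_le:
  fixes v w_opt :: "real ^ 'd"
  assumes opt: "optimal_of_sparsity f s w_opt" and v: "s \<le> sparsity v"
    and lip: "\<And>x y. \<bar>f x - f y\<bar> \<le> C * norm (x - y)"
  shows "f w_opt \<le> f v"
proof -
  define Z where "Z = {i. v $ i = 0}"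
  have "of_int \<lceil>s * real CARD('d)\<rceil> = real (card {i. w_opt $ i = 0})"
    using opt by (simp add: optimal_of_sparsity_def has_sparsity_def sparsity_def)
  \<comment> \<open>The ceiling is realized by \<open>w_opt\<close>, so it is a natural number even
    for negative s, and a subset of that size can be chosen.\<close>
  then have ceil: "\<lceil>s * real CARD('d)\<rceil> = int (card {i. w_opt $ i = 0})"
    by linarith
  have "s * real CARD('d) \<le> real (card Z)"
    using v by (simp add: sparsity_def Z_def field_simps)
  then have "\<lceil>s * real CARD('d)\<rceil> \<le> int (card Z)"
    by (simp add: ceiling_le_iff)
  then obtain Z' where Z': "Z' \<subseteq> Z" "int (card Z') = \<lceil>s * real CARD('d)\<rceil>"
    unfolding ceil by (metis obtain_subset_with_card_n of_nat_le_iff)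
  \<comment> \<open>Only the surplus zeros are lifted, to height r; all other entries stay as they
    are, so exactly \<open>Z'\<close> remains zero for each r > 0.\<close>
  define e :: "real ^ 'd" where "e = (\<chi> i. if i \<in> Z - Z' then 1 else 0)"
  have le: "f w_opt \<le> f v + C * norm (r *\<^sub>R e)" if "r > 0" for r
  proof -
    have "{i. (v + r *\<^sub>R e) $ i = 0} = Z'"
      using Z' that by (auto simp: e_def Z_def)
    then have "sparsity (v + r *\<^sub>R e) = real (card Z') / real CARD('d)"
      by (simp add: sparsity_def)
    also have "real (card Z') = of_int \<lceil>s * real CARD('d)\<rceil>"
      using Z'(2) by (metis of_int_of_nat_eq)
    finally have "has_sparsity s (v + r *\<^sub>R e)"
      by (simp add: has_sparsity_def)
    then have "f w_opt \<le> f (v + r *\<^sub>R e)"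
      using opt by (simp add: optimal_of_sparsity_def)
    also have "\<dots> \<le> f v + C * norm (r *\<^sub>R e)"
      using lip[of "v + r *\<^sub>R e" v] by simp
    finally show ?thesis .
  qed
  have "((\<lambda>r. f v + C * norm (r *\<^sub>R e)) \<longlongrightarrow> f v + C * norm (0 *\<^sub>R e)) (at_right 0)"
    by (intro tendsto_intros)
  then have "f w_opt \<le> f v + C * norm (0 *\<^sub>R e)"
    by (rule tendsto_lowerbound) (use le in \<open>auto intro!: eventually_at_rightI[of 0 1]\<close>)
  then show ?thesis
    by simp
qed

section \<open>Independence from the past\<close>

lemma norm_mult_vec_le: "norm (x * y) \<le> norm x * norm (y :: real ^ 'd)"
proof -
  have "norm (x * y) \<le> norm (norm y *\<^sub>R x)"
  proof (rule norm_le_componentwise_cart)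
    fix i
    have "\<bar>x $ i\<bar> * \<bar>y $ i\<bar> \<le> \<bar>x $ i\<bar> * norm y"
      by (intro mult_left_mono component_le_norm_cart) auto
    then show "norm ((x * y) $ i) \<le> norm ((norm y *\<^sub>R x) $ i)"
      by (simp add: abs_mult mult.commute)
  qed
  then show ?thesis
    by (simp add: mult.commute)
qed

lemma bounded_bilinear_mult_vec: "bounded_bilinear (\<lambda>x y :: real ^ 'd. x * y)"
proof
  show "\<exists>K. \<forall>a b :: real ^ 'd. norm (a * b) \<le> norm a * norm b * K"
    by (rule exI[of _ 1]) (simp add: norm_mult_vec_le)
qed (auto simp: vec_eq_iff algebra_simps)

lemma borel_measurable_mult_vec [measurable (raw)]:
  fixes f g :: "'a \<Rightarrow> real ^ 'd"
  assumes "f \<in> borel_measurable M" "g \<in> borel_measurable M"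
  shows "(\<lambda>x. f x * g x) \<in> borel_measurable M"
  using assms
  by (rule borel_measurable_continuous_Pair)
    (auto intro!: bounded_bilinear.continuous_on[OF bounded_bilinear_mult_vec] continuous_intros)

lemma inner_mult_vec: "inner (x * z) y = inner x (y * z)" for x y z :: "real ^ 'd"
  by (simp add: inner_vec_def mult_ac)

lemma norm_mult_mask_le:
  fixes x z :: "real ^ 'd"
  assumes "\<And>j. z $ j \<in> {0, 1}"
  shows "norm (x * z) \<le> norm x"
proof (rule norm_le_componentwise_cart)
  fix i
  show "norm ((x * z) $ i) \<le> norm (x $ i)"
    using assms[of i] by auto
qed

text \<open>Together with \<open>inner_mult_vec\<close>, which says that masking is self-adjoint,
  this makes masking an orthogonal projection.\<close>

lemma mask_mult_self:
  fixes z :: "real ^ 'd"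
  assumes "\<And>j. z $ j \<in> {0, 1}"
  shows "z * z = z"
  unfolding vec_eq_iff
proof
  fix i show "(z * z) $ i = z $ i"
    using assms[of i] by auto
qed

lemma borel_measurable_vec_lambda:
  fixes f :: "'d::finite \<Rightarrow> 'a \<Rightarrow> real"
  assumes "\<And>i. f i \<in> borel_measurable M"
  shows "(\<lambda>x. \<chi> i. f i x) \<in> borel_measurable M"
proof -
  have eq: "(\<lambda>x. \<chi> i. f i x) = (\<lambda>x. \<Sum>i\<in>UNIV. f i x *\<^sub>R axis i 1)"
    by (auto simp: vec_eq_iff axis_def if_distrib cong: if_cong)
  show ?thesis
    unfolding eq using assms by measurable
qed

lemma borel_measurable_vec_nth [measurable (raw)]:
  fixes f :: "'a \<Rightarrow> real ^ 'd"
  assumes "f \<in> borel_measurable M"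
  shows "(\<lambda>x. f x $ i) \<in> borel_measurable M"
  using assms by (rule measurable_compose)
    (intro borel_measurable_continuous_onI continuous_intros)

lemma borel_measurable_client_avg [measurable (raw)]:
  fixes f :: "'k::finite \<Rightarrow> 'a \<Rightarrow> 'b::{real_normed_vector, second_countable_topology}"
  assumes "\<And>k. f k \<in> borel_measurable M"
  shows "(\<lambda>x. client_avg (\<lambda>k. f k x)) \<in> borel_measurable M"
  unfolding client_avg_def using assms by measurable

lemma borel_measurable_purging_mask [measurable (raw)]:
  fixes f :: "'a \<Rightarrow> real ^ 'd"
  assumes [measurable]: "f \<in> borel_measurable M"
  shows "(\<lambda>x. purging_mask s (f x)) \<in> borel_measurable M"
proof -
  \<comment> \<open>As a finite sum of indicators of comparisons, the rank of an entry is measurable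
    in the vector.\<close>
  have card: "real (card {j. \<bar>v $ j\<bar> < \<bar>v $ i\<bar>}) = (\<Sum>j\<in>UNIV. if \<bar>v $ j\<bar> < \<bar>v $ i\<bar> then 1 else 0)"
    for v :: "real ^ 'd" and i
    by (simp flip: sum.inter_filter)
  show ?thesis
    unfolding purging_mask_def card by (intro borel_measurable_vec_lambda) measurable
qed

lemma borel_measurable_fed_mask [measurable (raw)]:
  fixes f :: "'k::finite \<Rightarrow> 'a \<Rightarrow> real ^ 'd"
  assumes [measurable]: "\<And>k. f k \<in> borel_measurable M"
  shows "(\<lambda>x. fed_mask variant s (\<lambda>k. f k x)) \<in> borel_measurable M"
proof (cases variant)
  case Sparsify_Global
  then show ?thesis by simp
next
  case Sparsify_Local
  then show ?thesis
    unfolding Sparsify_Local fed_mask.simps majority_vote_def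
    by (intro borel_measurable_vec_lambda) measurable
qed

lemma fed_mask_01: "fed_mask variant s u $ j \<in> {0, 1}"
  by (cases variant) (auto simp: purging_mask_def majority_vote_def)

context prob_space
begin

section \<open>Square integrable random vectors\<close>

definition square_integrable :: "('a \<Rightarrow> 'b::euclidean_space) \<Rightarrow> bool" where
  "square_integrable X \<longleftrightarrow> X \<in> borel_measurable M \<and> integrable M (\<lambda>\<omega>. (norm (X \<omega>))\<^sup>2)"

lemma square_integrable_add:
  assumes "square_integrable X" "square_integrable Y"
  shows "square_integrable (\<lambda>\<omega>. X \<omega> + Y \<omega>)"
proof -
  have [measurable]: "X \<in> borel_measurable M" "Y \<in> borel_measurable M"
    using assms by (auto simp: square_integrable_def)
  have "integrable M (\<lambda>\<omega>. (norm (X \<omega> + Y \<omega>))\<^sup>2)"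
  proof (rule Bochner_Integration.integrable_bound)
    show "integrable M (\<lambda>\<omega>. 2 * (norm (X \<omega>))\<^sup>2 + 2 * (norm (Y \<omega>))\<^sup>2)"
      using assms by (auto simp: square_integrable_def)
    have "(norm (x + y))\<^sup>2 \<le> 2 * (norm x)\<^sup>2 + 2 * (norm y)\<^sup>2" for x y :: 'b
      using zero_le_power2[of "norm (x - y)"]
      by (simp add: power2_norm_eq_inner inner_add_left inner_add_right inner_diff_left
          inner_diff_right inner_commute)
    then show "AE \<omega> in M. norm ((norm (X \<omega> + Y \<omega>))\<^sup>2)
        \<le> norm (2 * (norm (X \<omega>))\<^sup>2 + 2 * (norm (Y \<omega>))\<^sup>2)"
      by auto
  qed measurable
  then show ?thesis
    by (simp add: square_integrable_def)
qed

lemma square_integrable_scaleR: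
  "square_integrable X \<Longrightarrow> square_integrable (\<lambda>\<omega>. c *\<^sub>R X \<omega>)"
  by (auto simp: square_integrable_def power_mult_distrib)

lemma square_integrable_sum:
  assumes "\<And>i. i \<in> A \<Longrightarrow> square_integrable (X i)"
  shows "square_integrable (\<lambda>\<omega>. \<Sum>i\<in>A. X i \<omega>)"
  using assms
  by (induction A rule: infinite_finite_induct) (auto intro: square_integrable_add
      simp: square_integrable_def[of "\<lambda>_. 0"])

lemma square_integrable_client_avg:
  "(\<And>k. square_integrable (X k)) \<Longrightarrow> square_integrable (\<lambda>\<omega>. client_avg (\<lambda>k. X k \<omega>))"
  unfolding client_avg_def by (intro square_integrable_scaleR square_integrable_sum)

lemma square_integrable_bounded:
  assumes "X \<in> borel_measurable M" "\<And>\<omega>. \<omega> \<in> space M \<Longrightarrow> norm (X \<omega>) \<le> C"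
  shows "square_integrable X"
proof -
  have "AE \<omega> in M. norm ((norm (X \<omega>))\<^sup>2) \<le> C\<^sup>2"
    using assms by (auto intro!: AE_I2 power_mono)
  then show ?thesis
    using assms by (auto simp: square_integrable_def intro!: integrable_const_bound)
qed

lemma square_integrable_inner:
  assumes "square_integrable X" "square_integrable Y"
  shows "integrable M (\<lambda>\<omega>. inner (X \<omega>) (Y \<omega>))"
proof (rule Bochner_Integration.integrable_bound)
  have [measurable]: "X \<in> borel_measurable M" "Y \<in> borel_measurable M"
    using assms by (auto simp: square_integrable_def)
  show "integrable M (\<lambda>\<omega>. (norm (X \<omega>))\<^sup>2 + (norm (Y \<omega>))\<^sup>2)"
    using assms by (auto simp: square_integrable_def)
  have "\<bar>inner x y\<bar> \<le> (norm x)\<^sup>2 + (norm y)\<^sup>2" for x y :: 'b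
    using Cauchy_Schwarz_ineq2[of x y] sum_squares_bound[of "norm x" "norm y"]
      zero_le_power2[of "norm x"] zero_le_power2[of "norm y"] by linarith
  then show "AE \<omega> in M. norm (inner (X \<omega>) (Y \<omega>)) \<le> norm ((norm (X \<omega>))\<^sup>2 + (norm (Y \<omega>))\<^sup>2)"
    by auto
  show "(\<lambda>\<omega>. inner (X \<omega>) (Y \<omega>)) \<in> borel_measurable M"
    by measurable
qed

lemma square_integrable_imp_integrable:
  assumes "square_integrable X"
  shows "integrable M X"
proof (rule Bochner_Integration.integrable_bound)
  show "integrable M (\<lambda>\<omega>. 1 + (norm (X \<omega>))\<^sup>2)" "X \<in> borel_measurable M"
    using assms by (auto simp: square_integrable_def)
  have "norm x \<le> 1 + (norm x)\<^sup>2" for x :: 'b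
    using sum_squares_bound[of 1 "norm x"] norm_ge_zero[of x] unfolding power_one mult_1_right by linarith
  then show "AE \<omega> in M. norm (X \<omega>) \<le> norm (1 + (norm (X \<omega>))\<^sup>2)"
    by auto
qed

section \<open>Sigma-algebras of samples, and freezing the past\<close>

definition samples_algebra :: "('j \<Rightarrow> 's measure) \<Rightarrow> ('j \<Rightarrow> 'a \<Rightarrow> 's) \<Rightarrow> 'j set \<Rightarrow> 'a measure" where
  "samples_algebra D X J = vimage_algebra (space M) (\<lambda>\<omega>. \<lambda>j\<in>J. X j \<omega>) (PiM J D)"

lemma space_samples_algebra [simp]: "space (samples_algebra D X J) = space M"
  by (simp add: samples_algebra_def)

lemma measurable_samples_algebra:
  assumes "\<And>j. j \<in> J \<Longrightarrow> X j \<in> measurable M (D j)" "j \<in> J"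
  shows "X j \<in> measurable (samples_algebra D X J) (D j)"
proof -
  have "(\<lambda>\<omega>. \<lambda>j\<in>J. X j \<omega>) \<in> measurable (samples_algebra D X J) (PiM J D)"
    unfolding samples_algebra_def
    using assms(1) by (intro measurable_vimage_algebra1) (auto simp: space_PiM measurable_space[OF assms(1)])
  from measurable_compose[OF this measurable_component_singleton[OF assms(2)]]
  show ?thesis
    using assms(2) by simp
qed

lemma sets_samples_algebra_le:
  assumes "space N = space M" "\<And>j. j \<in> J \<Longrightarrow> X j \<in> measurable N (D j)"
  shows "sets (samples_algebra D X J) \<subseteq> sets N"
  unfolding samples_algebra_def
  by (rule sets_image_in_sets) (use assms in \<open>auto intro!: measurable_restrict\<close>)

lemma sets_samples_algebra_mono:
  assumes "\<And>i. i \<in> I \<Longrightarrow> X i \<in> measurable M (D i)" "J \<subseteq> I"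
  shows "sets (samples_algebra D X J) \<subseteq> sets (samples_algebra D X I)"
  using assms by (intro sets_samples_algebra_le measurable_samples_algebra) auto

text \<open>The join of both sigma-algebras. Intersections are taken as generators because they form
  a pi-system on which independence is a computation with probabilities.\<close>

definition history ::
  "'a measure \<Rightarrow> ('j \<Rightarrow> 's measure) \<Rightarrow> ('j \<Rightarrow> 'a \<Rightarrow> 's) \<Rightarrow> 'j set \<Rightarrow> 'a measure" where
  "history N D X J =
     sigma (space M) {A \<inter> B | A B. A \<in> sets N \<and> B \<in> sets (samples_algebra D X J)}"

lemma
  assumes "space N = space M"
  shows space_history: "space (history N D X J) = space M"
    and sets_history: "sets (history N D X J) =
      sigma_sets (space M) {A \<inter> B | A B. A \<in> sets N \<and> B \<in> sets (samples_algebra D X J)}"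
proof -
  have "{A \<inter> B | A B. A \<in> sets N \<and> B \<in> sets (samples_algebra D X J)} \<subseteq> Pow (space M)"
    using sets.sets_into_space[of _ N] assms by auto
  then show "space (history N D X J) = space M"
    "sets (history N D X J) =
      sigma_sets (space M) {A \<inter> B | A B. A \<in> sets N \<and> B \<in> sets (samples_algebra D X J)}"
    by (auto simp: history_def)
qed

lemma sets_le_history:
  assumes "space N = space M"
  shows "sets N \<subseteq> sets (history N D X J)" "sets (samples_algebra D X J) \<subseteq> sets (history N D X J)"
proof -
  show "sets N \<subseteq> sets (history N D X J)"
  proof
    fix A assume A: "A \<in> sets N"
    then have "A = A \<inter> space M"
      using assms sets.sets_into_space by blast
    moreover have "space M \<in> sets (samples_algebra D X J)"
      by (metis sets.top space_samples_algebra)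
    ultimately show "A \<in> sets (history N D X J)"
      unfolding sets_history[OF assms] using A by blast
  qed
  show "sets (samples_algebra D X J) \<subseteq> sets (history N D X J)"
  proof
    fix B assume B: "B \<in> sets (samples_algebra D X J)"
    then have "B = space M \<inter> B"
      using sets.sets_into_space by fastforce
    moreover have "space M \<in> sets N"
      using assms by (metis sets.top)
    ultimately show "B \<in> sets (history N D X J)"
      unfolding sets_history[OF assms] using B by blast
  qed
qed

lemma sets_history_le:
  assumes "space N = space M" "space H = space M" "sets N \<subseteq> sets H"
    and "sets (samples_algebra D X J) \<subseteq> sets H"
  shows "sets (history N D X J) \<subseteq> sets H"
  unfolding sets_history[OF assms(1)] assms(2)[symmetric]
  using assms(3,4) by (intro sets.sigma_sets_subset) auto

text \<open>\<open>N\<close> stands for the random start. On the generators, P(A B C) = P(A) P(B C)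
  = P(A) P(B) P(C) = P(A B) P(C), and stability under intersections extends this to the whole
  history.\<close>

lemma indep_set_history:
  assumes N: "space N = space M"
    and X: "indep_vars D X I"
    and NX: "indep_set (sets N) (sets (samples_algebra D X I))"
    and JK: "J \<subseteq> I" "K \<subseteq> I" "J \<inter> K = {}"
  shows "indep_set (sets (history N D X J)) (sets (samples_algebra D X K))"
proof -
  have rv: "X i \<in> measurable M (D i)" if "i \<in> I" for i
    using X that by (auto simp: indep_vars_def2)
  have sub: "sets (samples_algebra D X J') \<subseteq> sets (samples_algebra D X I)" if "J' \<subseteq> I" for J'
    using that by (intro sets_samples_algebra_mono rv)
  have subM: "sets (samples_algebra D X J') \<subseteq> events" if "J' \<subseteq> I" for J'
    using that by (intro sets_samples_algebra_le rv) auto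
  have NM: "sets N \<subseteq> events"
    using NX by (rule indep_setD_ev1)
  let ?\<A> = "{A \<inter> B | A B. A \<in> sets N \<and> B \<in> sets (samples_algebra D X J)}"
  have XJK: "indep_set (sets (samples_algebra D X J)) (sets (samples_algebra D X K))"
    using indep_var_restrict[OF X JK(3,1,2)]
    unfolding indep_var_eq samples_algebra_def sets_vimage_algebra by blast
  have "indep_set ?\<A> (sets (samples_algebra D X K))"
  proof (rule indep_setI)
    show "?\<A> \<subseteq> events"
      using NM subM[OF JK(1)] by blast
    show "sets (samples_algebra D X K) \<subseteq> events"
      by (rule subM[OF JK(2)])
    fix E C assume "E \<in> ?\<A>" and C: "C \<in> sets (samples_algebra D X K)"
    then obtain A B where E: "E = A \<inter> B" "A \<in> sets N" "B \<in> sets (samples_algebra D X J)"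
      by blast
    have BI: "B \<in> sets (samples_algebra D X I)" and CI: "C \<in> sets (samples_algebra D X I)"
      using E(3) C sub JK by blast+
    have "prob (E \<inter> C) = prob (A \<inter> (B \<inter> C))"
      by (simp add: E(1) Int_assoc)
    \<comment> \<open>Independence of A from B and from C separately would not give this;
      \<open>B \<inter> C\<close> is an event of the algebra of all samples, from which
      \<open>N\<close> is independent.\<close>
    also have "\<dots> = prob A * prob (B \<inter> C)"
      by (rule indep_setD[OF NX E(2)]) (use BI CI in blast)
    also have "prob (B \<inter> C) = prob B * prob C"
      by (rule indep_setD[OF XJK E(3) C])
    also have "prob A * (prob B * prob C) = prob (A \<inter> B) * prob C"
      by (simp add: indep_setD[OF NX E(2) BI])
    finally show "prob (E \<inter> C) = prob E * prob C"
      by (simp add: E(1))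
  qed
  then have "indep_set (sigma_sets (space M) ?\<A>)
      (sigma_sets (space M) (sets (samples_algebra D X K)))"
  proof (rule indep_set_sigma_sets)
    show "Int_stable ?\<A>"
    proof (rule Int_stableI)
      fix a b assume "a \<in> ?\<A>" "b \<in> ?\<A>"
      then obtain A B A' B' where "a = A \<inter> B" "b = A' \<inter> B'" "A \<in> sets N" "A' \<in> sets N"
        "B \<in> sets (samples_algebra D X J)" "B' \<in> sets (samples_algebra D X J)"
        by blast
      then show "a \<inter> b \<in> ?\<A>"
        by (intro CollectI exI[of _ "A \<inter> A'"] exI[of _ "B \<inter> B'"]) auto
    qed
    show "Int_stable (sets (samples_algebra D X K))"
      by (auto intro: Int_stableI)
  qed
  then show ?thesis
    using sets.sigma_sets_eq[of "samples_algebra D X K"] by (simp add: sets_history[OF N])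
qed

text \<open>Freezing the past: the joint law of the outcome seen through \<open>N\<close> and of
  \<open>Y\<close> is a product, so \<open>Y\<close> can be integrated out at a fixed outcome. The
  version in ennreal serves to establish integrability, the signed one to evaluate means of
  zero.\<close>

lemma
  fixes h :: "'a \<Rightarrow> 'b \<Rightarrow> real"
  assumes N: "space N = space M" and Y: "Y \<in> measurable M P" "distr M P Y = P"
    and ind: "indep_set (sets N) {Y -` C \<inter> space M | C. C \<in> sets P}"
    and h: "case_prod h \<in> borel_measurable (N \<Otimes>\<^sub>M P)"
  shows nn_integral_independent:
      "(\<integral>\<^sup>+\<omega>. ennreal (h \<omega> (Y \<omega>)) \<partial>M) = (\<integral>\<^sup>+\<omega>. (\<integral>\<^sup>+z. ennreal (h \<omega> z) \<partial>P) \<partial>M)"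
    and integral_independent: "integrable M (\<lambda>\<omega>. h \<omega> (Y \<omega>)) \<Longrightarrow>
      (\<integral>\<omega>. h \<omega> (Y \<omega>) \<partial>M) = (\<integral>\<omega>. (\<integral>z. h \<omega> z \<partial>P) \<partial>M)"
proof -
  have NM: "sets N \<subseteq> events"
    using ind by (rule indep_setD_ev1)
  then have [measurable]: "(\<lambda>\<omega>. \<omega>) \<in> measurable M N"
    using sets.sets_into_space[of _ N] by (intro measurableI) (auto simp: N Int_absorb2)
  note [measurable] = Y(1) h
  interpret P: prob_space P
    using prob_space_distr[of Y P] Y by simp
  interpret N: prob_space "distr M N (\<lambda>\<omega>. \<omega>)"
    by (rule prob_space_distr) simp
  interpret NP: pair_sigma_finite "distr M N (\<lambda>\<omega>. \<omega>)" P ..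
  \<comment> \<open>Pushing M forward to \<open>N\<close> by the identity lets \<open>h\<close> be
    jointly measurable with respect to the past alone. On rectangles the two measures agree by
    independence.\<close>
  have eq: "distr M N (\<lambda>\<omega>. \<omega>) \<Otimes>\<^sub>M P = distr M (N \<Otimes>\<^sub>M P) (\<lambda>\<omega>. (\<omega>, Y \<omega>))"
  proof (rule pair_measure_eqI)
    show "sigma_finite_measure (distr M N (\<lambda>\<omega>. \<omega>))" "sigma_finite_measure P"
      by unfold_locales
    show "sets (distr M N (\<lambda>\<omega>. \<omega>) \<Otimes>\<^sub>M P) = sets (distr M (N \<Otimes>\<^sub>M P) (\<lambda>\<omega>. (\<omega>, Y \<omega>)))"
      unfolding sets_distr by (intro sets_pair_measure_cong) auto
    fix A B assume A: "A \<in> sets (distr M N (\<lambda>\<omega>. \<omega>))" and B: "B \<in> sets P"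
    then have A': "A \<in> sets N" "A \<subseteq> space M" "A \<in> events"
      using NM sets.sets_into_space[of A N] N by auto
    have "emeasure (distr M N (\<lambda>\<omega>. \<omega>)) A = prob A"
      using A' by (simp add: emeasure_distr Int_absorb2 emeasure_eq_measure)
    moreover have "emeasure P B = prob (Y -` B \<inter> space M)"
    proof -
      have "emeasure P B = emeasure (distr M P Y) B"
        by (simp add: Y)
      then show ?thesis
        using B by (simp add: emeasure_distr Y(1) emeasure_eq_measure)
    qed
    moreover have "emeasure (distr M (N \<Otimes>\<^sub>M P) (\<lambda>\<omega>. (\<omega>, Y \<omega>))) (A \<times> B)
        = prob (A \<inter> (Y -` B \<inter> space M))"
    proof -
      have "(\<lambda>\<omega>. (\<omega>, Y \<omega>)) -` (A \<times> B) \<inter> space M = A \<inter> (Y -` B \<inter> space M)"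
        by auto
      then show ?thesis
        using A' B by (subst emeasure_distr) (auto simp: emeasure_eq_measure)
    qed
    moreover have "prob (A \<inter> (Y -` B \<inter> space M)) = prob A * prob (Y -` B \<inter> space M)"
      by (rule indep_setD[OF ind]) (use A' B in auto)
    ultimately show "emeasure (distr M N (\<lambda>\<omega>. \<omega>)) A * emeasure P B
        = emeasure (distr M (N \<Otimes>\<^sub>M P) (\<lambda>\<omega>. (\<omega>, Y \<omega>))) (A \<times> B)"
      by (simp add: ennreal_mult)
  qed
  have "(\<integral>\<^sup>+\<omega>. ennreal (h \<omega> (Y \<omega>)) \<partial>M)
      = (\<integral>\<^sup>+x. ennreal (case_prod h x) \<partial>distr M (N \<Otimes>\<^sub>M P) (\<lambda>\<omega>. (\<omega>, Y \<omega>)))"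
    by (subst nn_integral_distr) auto
  also have "\<dots> = (\<integral>\<^sup>+\<omega>. (\<integral>\<^sup>+z. ennreal (h \<omega> z) \<partial>P) \<partial>distr M N (\<lambda>\<omega>. \<omega>))"
    unfolding eq[symmetric] by (subst P.nn_integral_fst[symmetric]) auto
  also have "\<dots> = (\<integral>\<^sup>+\<omega>. (\<integral>\<^sup>+z. ennreal (h \<omega> z) \<partial>P) \<partial>M)"
    by (subst nn_integral_distr) auto
  finally show "(\<integral>\<^sup>+\<omega>. ennreal (h \<omega> (Y \<omega>)) \<partial>M) = (\<integral>\<^sup>+\<omega>. (\<integral>\<^sup>+z. ennreal (h \<omega> z) \<partial>P) \<partial>M)" .
  assume "integrable M (\<lambda>\<omega>. h \<omega> (Y \<omega>))"
  then have int: "integrable (distr M N (\<lambda>\<omega>. \<omega>) \<Otimes>\<^sub>M P) (case_prod h)"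
    unfolding eq by (subst integrable_distr_eq) auto
  have "(\<integral>\<omega>. h \<omega> (Y \<omega>) \<partial>M) = (\<integral>x. case_prod h x \<partial>distr M (N \<Otimes>\<^sub>M P) (\<lambda>\<omega>. (\<omega>, Y \<omega>)))"
    by (subst integral_distr) auto
  also have "\<dots> = (\<integral>\<omega>. (\<integral>z. h \<omega> z \<partial>P) \<partial>distr M N (\<lambda>\<omega>. \<omega>))"
    unfolding eq[symmetric] NP.integral_fst'[OF int, symmetric] by simp
  also have "\<dots> = (\<integral>\<omega>. (\<integral>z. h \<omega> z \<partial>P) \<partial>M)"
    by (subst integral_distr) auto
  finally show "(\<integral>\<omega>. h \<omega> (Y \<omega>) \<partial>M) = (\<integral>\<omega>. (\<integral>z. h \<omega> z \<partial>P) \<partial>M)" .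
qed

end

section \<open>The stochastic process\<close>

text \<open>The pruning schedule is abstracted to a sequence of levels \<open>s\<close>: the descent
  holds for all levels, and the formula matters only through its value in the last round.\<close>

locale fedsparsify = prob_space M
  for M :: "'a measure" +
  fixes f_loc :: "'k::finite \<Rightarrow> real ^ 'd \<Rightarrow> real"
    and f :: "real ^ 'd \<Rightarrow> real"
    and D :: "'k \<Rightarrow> 's measure"
    and G :: "'k \<Rightarrow> real ^ 'd \<Rightarrow> 's \<Rightarrow> real ^ 'd"
    and \<xi> :: "'k \<Rightarrow> nat \<Rightarrow> nat \<Rightarrow> 'a \<Rightarrow> 's"
    and w m :: "nat \<Rightarrow> 'a \<Rightarrow> real ^ 'd"
    and u :: "'k \<Rightarrow> nat \<Rightarrow> nat \<Rightarrow> 'a \<Rightarrow> real ^ 'd"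
    and L L\<^sub>p \<sigma> \<epsilon> \<eta> :: real
    and T S :: nat
    and s :: "nat \<Rightarrow> real"
    and variant :: fed_variant
    and I :: "('k \<times> nat \<times> nat) set"
  assumes I_def: "I = UNIV \<times> {1..T} \<times> {..<S}"
    and f_def: "\<And>x. f x = client_avg (\<lambda>k. f_loc k x)"
    and L_pos: "L > 0"
    and differentiable: "\<And>k x. f_loc k differentiable (at x)"
    and smooth: "\<And>k x y. norm (gradient (f_loc k) x - gradient (f_loc k) y) \<le> L * norm (x - y)"
    and lipschitz: "\<And>x y. \<bar>f x - f y\<bar> \<le> L\<^sub>p * norm (x - y)"
    and sample_dist: "\<And>k. prob_space (D k)"
    and oracle_measurable: "\<And>k. (\<lambda>(x, z). G k x z) \<in> borel_measurable (borel \<Otimes>\<^sub>M D k)"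
    and unbiased: "\<And>k x. integrable (D k) (G k x)"
      "\<And>k x. (\<integral>z. G k x z \<partial>D k) = gradient (f_loc k) x"
    and variance: "\<And>k x. integrable (D k) (\<lambda>z. (norm (G k x z - gradient (f_loc k) x))\<^sup>2)"
      "\<And>k x. (\<integral>z. (norm (G k x z - gradient (f_loc k) x))\<^sup>2 \<partial>D k) \<le> \<sigma>\<^sup>2"
    and deviation: "\<And>k x. (norm (gradient f x - gradient (f_loc k) x))\<^sup>2 \<le> \<epsilon>\<^sup>2"
    and samples: "\<And>k t i. (k, t, i) \<in> I \<Longrightarrow> distr M (D k) (\<xi> k t i) = D k"
    and indep: "indep_vars (\<lambda>(k, t, i). D k) (\<lambda>(k, t, i). \<xi> k t i) I"
    and init: "integrable M (w 1)" "m 1 \<in> borel_measurable M"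
      "\<And>\<omega> j. \<omega> \<in> space M \<Longrightarrow> m 1 \<omega> $ j \<in> {0, 1}"
    and init_indep: "indep_set
        (sets (vimage_algebra (space M) (\<lambda>\<omega>. (w 1 \<omega>, m 1 \<omega>)) (borel \<Otimes>\<^sub>M borel)))
        (sets (vimage_algebra (space M) (\<lambda>\<omega>. \<lambda>(k, t, i)\<in>I. \<xi> k t i \<omega>)
          (PiM I (\<lambda>(k, t, i). D k))))"
    and S_pos: "S > 0"
    and step_size: "\<eta> > 0" "\<eta> < 1 / (4 * sqrt 2 * L * real S)"
    and run: "\<And>\<omega>. \<omega> \<in> space M \<Longrightarrow>
        fedsparsify_run variant T S s \<eta>
          (\<lambda>k t i x. G k x (\<xi> k t i \<omega>)) (\<lambda>t. w t \<omega>) (\<lambda>t. m t \<omega>) (\<lambda>k t i. u k t i \<omega>)"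
begin

section \<open>The global objective: smoothness and bounded gradients\<close>

lemma GDERIV_global: "GDERIV f x :> client_avg (\<lambda>k. gradient (f_loc k) x)"
proof -
  have "(f_loc k has_derivative (\<lambda>h. inner h (gradient (f_loc k) x))) (at x)" for k
    using GDERIV_gradient[OF differentiable] by (simp add: gderiv_def)
  then have "((\<lambda>x. (1 / real CARD('k)) *\<^sub>R (\<Sum>k\<in>UNIV. f_loc k x)) has_derivative
      (\<lambda>h. (1 / real CARD('k)) *\<^sub>R (\<Sum>k\<in>UNIV. inner h (gradient (f_loc k) x)))) (at x)"
    by (intro has_derivative_scaleR_right has_derivative_sum)
  moreover have "f = (\<lambda>x. (1 / real CARD('k)) *\<^sub>R (\<Sum>k\<in>UNIV. f_loc k x))"
    by (simp add: fun_eq_iff f_def client_avg_def)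
  moreover have "(\<lambda>h. (1 / real CARD('k)) *\<^sub>R (\<Sum>k\<in>UNIV. inner h (gradient (f_loc k) x)))
      = (\<lambda>h. inner h (client_avg (\<lambda>k. gradient (f_loc k) x)))"
    by (simp only: client_avg_inner) (simp add: client_avg_def)
  ultimately show ?thesis
    by (simp only: gderiv_def)
qed

lemma gradient_global: "gradient f x = client_avg (\<lambda>k. gradient (f_loc k) x)"
  by (rule gradient_eqI[OF GDERIV_global])

lemma smooth_global: "norm (gradient f x - gradient f y) \<le> L * norm (x - y)"
proof -
  have "(norm (gradient f x - gradient f y))\<^sup>2
      \<le> client_avg (\<lambda>k. (norm (gradient (f_loc k) x - gradient (f_loc k) y))\<^sup>2)"
    unfolding gradient_global client_avg_diff[symmetric] by (rule norm_client_avg_sq_le)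
  also have "\<dots> \<le> client_avg (\<lambda>k::'k. (L * norm (x - y))\<^sup>2)"
    by (intro client_avg_mono power_mono smooth) simp
  finally have "(norm (gradient f x - gradient f y))\<^sup>2 \<le> (L * norm (x - y))\<^sup>2"
    by simp
  then show ?thesis
    by (rule power2_le_imp_le) (use L_pos in simp)
qed

lemma norm_gradient_global_le: "norm (gradient f x) \<le> L\<^sub>p"
proof (rule norm_gradient_le[OF _ lipschitz])
  show "f differentiable (at x)"
    using GDERIV_global[of x] by (auto simp: gderiv_def differentiable_def)
qed

text \<open>Boundedness passes from the global gradient to the local ones through the deviation of
  the clients. The absolute value is there because \<open>\<epsilon>\<close> may be
  negative.\<close>

lemma norm_gradient_local_le: "norm (gradient (f_loc k) x) \<le> L\<^sub>p + \<bar>\<epsilon>\<bar>"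
proof -
  have "(norm (gradient f x - gradient (f_loc k) x))\<^sup>2 \<le> \<bar>\<epsilon>\<bar>\<^sup>2"
    using deviation by simp
  then have "norm (gradient f x - gradient (f_loc k) x) \<le> \<bar>\<epsilon>\<bar>"
    by (rule power2_le_imp_le) simp
  then show ?thesis
    using norm_gradient_global_le[of x]
      norm_triangle_ineq4[of "gradient f x" "gradient f x - gradient (f_loc k) x"] by simp
qed

lemma borel_measurable_lipschitz:
  fixes g :: "real ^ 'd \<Rightarrow> 'b::real_normed_vector"
  assumes "\<And>x y. norm (g x - g y) \<le> C * norm (x - y)" "0 \<le> C"
  shows "g \<in> borel_measurable borel"
proof (rule borel_measurable_continuous_onI)
  have "C-lipschitz_on UNIV g"
    using assms by (auto simp: lipschitz_on_def dist_norm)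
  then show "continuous_on UNIV g"
    by (rule lipschitz_on_continuous_on)
qed

lemma borel_measurable_gradient [measurable]:
  "gradient f \<in> borel_measurable borel" "gradient (f_loc k) \<in> borel_measurable borel"
  using smooth_global smooth L_pos by (auto intro!: borel_measurable_lipschitz[where C = L])

lemma L\<^sub>p_nonneg: "0 \<le> L\<^sub>p"
  using norm_gradient_global_le[of 0] norm_ge_zero[of "gradient f 0"] by linarith

lemma borel_measurable_f [measurable]: "f \<in> borel_measurable borel"
  using lipschitz L\<^sub>p_nonneg by (intro borel_measurable_lipschitz[of f L\<^sub>p]) auto

lemma round_in_run:
  assumes "\<omega> \<in> space M" "t \<in> {1..T}"
  shows local_init: "u k t 0 \<omega> = w t \<omega>"
    and local_step: "i < S \<Longrightarrow>
      u k t (Suc i) \<omega> = u k t i \<omega> - \<eta> *\<^sub>R (G k (u k t i \<omega>) (\<xi> k t i \<omega>) * m t \<omega>)"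
    and mask_update: "m (Suc t) \<omega> = m t \<omega> * fed_mask variant (s t) (\<lambda>k. u k t S \<omega>)"
    and server_update: "w (Suc t) \<omega> = client_avg (\<lambda>k. u k t S \<omega>) * m (Suc t) \<omega>"
  using run[OF assms(1)] assms(2) unfolding fedsparsify_run_def by blast+

lemma mask_01:
  assumes "\<omega> \<in> space M" "t \<in> {1..Suc T}"
  shows "m t \<omega> $ j \<in> {0, 1}"
  using assms(2)
proof (induction t rule: nat_induct)
  case (Suc t)
  show ?case
  proof (cases "t = 0")
    case True
    then show ?thesis
      using init(3)[OF assms(1), of j] by simp
  next
    case False
    then have t: "t \<in> {1..T}"
      using Suc by auto
    then have "m t \<omega> $ j \<in> {0, 1}"
      using Suc by auto
    then show ?thesis
      using fed_mask_01[of variant "s t" "\<lambda>k. u k t S \<omega>" j]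
      by (auto simp: mask_update[OF assms(1) t])
  qed
qed simp

section \<open>Filtration of the samples, and adaptedness\<close>

definition initial :: "'a measure" where
  "initial = vimage_algebra (space M) (\<lambda>\<omega>. (w 1 \<omega>, m 1 \<omega>)) (borel \<Otimes>\<^sub>M borel)"

text \<open>What is known just before local step i of round t. All clients advance in parallel:
  their samples at (t, i) are all left out, and \<open>past (Suc t) 0\<close> contains round t
  completely.\<close>

definition past :: "nat \<Rightarrow> nat \<Rightarrow> 'a measure" where
  "past t i = history initial (\<lambda>(k, t, i). D k) (\<lambda>(k, t, i). \<xi> k t i)
     {(k, t', i') \<in> I. t' < t \<or> t' = t \<and> i' < i}"

lemma space_initial [simp]: "space initial = space M"
  by (simp add: initial_def)

lemma space_past [simp]: "space (past t i) = space M"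
  by (simp add: past_def space_history)

lemma sample_measurable: "(k, t, i) \<in> I \<Longrightarrow> \<xi> k t i \<in> measurable M (D k)"
  using indep by (auto simp: indep_vars_def2)

lemma samples_measurable:
  "J \<subseteq> I \<Longrightarrow> j \<in> J \<Longrightarrow> (case j of (k, t, i) \<Rightarrow> \<xi> k t i) \<in> measurable M (case j of (k, t, i) \<Rightarrow> D k)"
  using sample_measurable by (cases j) auto

lemma initial_indep:
  "indep_set (sets initial) (sets (samples_algebra (\<lambda>(k, t, i). D k) (\<lambda>(k, t, i). \<xi> k t i) I))"
proof -
  have "(\<lambda>\<omega>. \<lambda>(k, t, i)\<in>I. \<xi> k t i \<omega>) = (\<lambda>\<omega>. \<lambda>j\<in>I. (case j of (k, t, i) \<Rightarrow> \<xi> k t i) \<omega>)"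
    by (auto simp: fun_eq_iff)
  then show ?thesis
    using init_indep unfolding initial_def samples_algebra_def by (simp add: case_prod_beta)
qed

lemma sample_measurable_past:
  assumes "(k, t', i') \<in> I" "t' < t \<or> t' = t \<and> i' < i"
  shows "\<xi> k t' i' \<in> measurable (past t i) (D k)"
proof -
  let ?J = "{(k, t', i') \<in> I. t' < t \<or> t' = t \<and> i' < i}"
  have "(case (k, t', i') of (k, t, i) \<Rightarrow> \<xi> k t i) \<in> measurable
      (samples_algebra (\<lambda>(k, t, i). D k) (\<lambda>(k, t, i). \<xi> k t i) ?J) (case (k, t', i') of (k, t, i) \<Rightarrow> D k)"
    by (rule measurable_samples_algebra) (use assms in \<open>auto intro: sample_measurable\<close>)
  then have "\<xi> k t' i' \<in> measurable (samples_algebra (\<lambda>(k, t, i). D k) (\<lambda>(k, t, i). \<xi> k t i) ?J) (D k)"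
    by simp
  then show ?thesis
    using sets_le_history(2)[OF space_initial, of "\<lambda>(k, t, i). D k" "\<lambda>(k, t, i). \<xi> k t i" ?J]
    unfolding past_def by (auto simp: measurable_def space_history)
qed

lemma past_mono:
  assumes "t < t' \<or> t = t' \<and> i \<le> i'"
  shows "measurable (past t i) N \<subseteq> measurable (past t' i') N"
proof -
  have "sets (past t i) \<subseteq> sets (past t' i')"
  proof -
    have "sets (samples_algebra (\<lambda>(k, t, i). D k) (\<lambda>(k, t, i). \<xi> k t i)
          {(k, t'', i'') \<in> I. t'' < t \<or> t'' = t \<and> i'' < i}) \<subseteq> sets (past t' i')"
    proof (rule sets_samples_algebra_le)
      fix j assume j: "j \<in> {(k, t'', i'') \<in> I. t'' < t \<or> t'' = t \<and> i'' < i}"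
      obtain k t'' i'' where "j = (k, t'', i'')"
        by (cases j)
      with j assms show "(case j of (k, t, i) \<Rightarrow> \<xi> k t i)
          \<in> measurable (past t' i') (case j of (k, t, i) \<Rightarrow> D k)"
        by (auto intro: sample_measurable_past)
    qed simp
    moreover have "sets initial \<subseteq> sets (past t' i')"
      unfolding past_def by (rule sets_le_history) simp
    ultimately show ?thesis
      unfolding past_def[of t i] by (intro sets_history_le) simp_all
  qed
  then show ?thesis
    by (auto simp: measurable_def)
qed

lemma past_measurable: "measurable (past t i) N \<subseteq> measurable M N"
proof -
  let ?J = "{(k, t', i') \<in> I. t' < t \<or> t' = t \<and> i' < i}"
  have "sets (samples_algebra (\<lambda>(k, t, i). D k) (\<lambda>(k, t, i). \<xi> k t i) ?J) \<subseteq> events"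
    by (intro sets_samples_algebra_le samples_measurable) auto
  then have "sets (past t i) \<subseteq> events"
    unfolding past_def
    by (intro sets_history_le space_initial indep_setD_ev1[OF initial_indep]) auto
  then show ?thesis
    by (auto simp: measurable_def)
qed

lemma past_indep:
  assumes "(k, t, i) \<in> I"
  shows "indep_set (sets (past t i)) {\<xi> k t i -` C \<inter> space M | C. C \<in> sets (D k)}"
proof -
  let ?SA = "samples_algebra (\<lambda>(k, t, i). D k) (\<lambda>(k, t, i). \<xi> k t i) {(k, t, i)}"
  have ind: "indep_set (sets (past t i)) (sets ?SA)"
    unfolding past_def using assms
    by (intro indep_set_history[OF _ indep initial_indep]) auto
  have "(case (k, t, i) of (k, t, i) \<Rightarrow> \<xi> k t i) \<in> measurable ?SA (case (k, t, i) of (k, t, i) \<Rightarrow> D k)"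
    by (rule measurable_samples_algebra) (use assms in \<open>auto intro: sample_measurable\<close>)
  then have "{\<xi> k t i -` C \<inter> space M | C. C \<in> sets (D k)} \<subseteq> sets ?SA"
    using measurable_sets[of "\<xi> k t i" ?SA "D k"] by auto
  then show ?thesis
    using ind unfolding indep_sets2_eq by blast
qed

text \<open>Step i consumes a sample that enters the past at \<open>Suc i\<close> only, so the index
  i of the past matches the model before that step.\<close>

lemma local_models_adapted:
  assumes t: "t \<in> {1..T}" and wm: "w t \<in> borel_measurable (past t 0)" "m t \<in> borel_measurable (past t 0)"
  shows "i \<le> S \<Longrightarrow> u k t i \<in> borel_measurable (past t i)"
proof (induction i)
  case 0
  have "u k t 0 \<in> borel_measurable (past t 0) \<longleftrightarrow> w t \<in> borel_measurable (past t 0)"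
    using t by (intro measurable_cong) (simp add: local_init)
  then show ?case
    using wm by simp
next
  case (Suc i)
  have [measurable]: "u k t i \<in> borel_measurable (past t (Suc i))"
    "m t \<in> borel_measurable (past t (Suc i))"
    using Suc past_mono[of t t i "Suc i" borel] past_mono[of t t 0 "Suc i" borel] wm by auto
  have [measurable]: "\<xi> k t i \<in> measurable (past t (Suc i)) (D k)"
    using Suc t by (intro sample_measurable_past) (auto simp: I_def)
  note [measurable] = oracle_measurable[of k]
  have "(\<lambda>\<omega>. u k t i \<omega> - \<eta> *\<^sub>R (G k (u k t i \<omega>) (\<xi> k t i \<omega>) * m t \<omega>))
      \<in> borel_measurable (past t (Suc i))"
    by measurable
  \<comment> \<open>The update rule holds on \<open>space M\<close>, hence a congruence over that
    space and not a rewriting of functions.\<close>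
  also have "?this \<longleftrightarrow> u k t (Suc i) \<in> borel_measurable (past t (Suc i))"
    using Suc t by (intro measurable_cong) (simp add: local_step)
  finally show ?case .
qed

lemma params_adapted:
  assumes "t \<in> {1..Suc T}"
  shows "w t \<in> borel_measurable (past t 0) \<and> m t \<in> borel_measurable (past t 0)"
  using assms
proof (induction t rule: nat_induct)
  case (Suc t)
  show ?case
  proof (cases "t = 0")
    case True
    have *: "(\<lambda>\<omega>. (w 1 \<omega>, m 1 \<omega>)) \<in> measurable initial (borel \<Otimes>\<^sub>M borel)"
      unfolding initial_def by (rule measurable_vimage_algebra1) (auto simp: space_pair_measure)
    have "sets initial \<subseteq> sets (past 1 0)"
      unfolding past_def by (rule sets_le_history) simp
    then have "(\<lambda>\<omega>. (w 1 \<omega>, m 1 \<omega>)) \<in> measurable (past 1 0) (borel \<Otimes>\<^sub>M borel)"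
      using * by (auto simp: measurable_def)
    from measurable_compose[OF this measurable_fst] measurable_compose[OF this measurable_snd]
    show ?thesis
      using True by simp
  next
    case False
    then have t: "t \<in> {1..T}"
      using Suc by auto
    then have IH: "w t \<in> borel_measurable (past t 0)" "m t \<in> borel_measurable (past t 0)"
      using Suc by auto
    have [measurable]: "m t \<in> borel_measurable (past (Suc t) 0)"
      "u k t S \<in> borel_measurable (past (Suc t) 0)" for k
      using local_models_adapted[OF t IH, of S k] IH past_mono[of t "Suc t" S 0 borel]
        past_mono[of t "Suc t" 0 0 borel] by auto
    have "(\<lambda>\<omega>. m t \<omega> * fed_mask variant (s t) (\<lambda>k. u k t S \<omega>)) \<in> borel_measurable (past (Suc t) 0)"
      by measurable
    also have "?this \<longleftrightarrow> m (Suc t) \<in> borel_measurable (past (Suc t) 0)"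
      using t by (intro measurable_cong) (simp add: mask_update)
    finally have [measurable]: "m (Suc t) \<in> borel_measurable (past (Suc t) 0)" .
    have "(\<lambda>\<omega>. client_avg (\<lambda>k. u k t S \<omega>) * m (Suc t) \<omega>) \<in> borel_measurable (past (Suc t) 0)"
      by measurable
    also have "?this \<longleftrightarrow> w (Suc t) \<in> borel_measurable (past (Suc t) 0)"
      using t by (intro measurable_cong) (simp add: server_update)
    finally show ?thesis
      by simp
  qed
qed simp

lemma
  assumes "t \<in> {1..T}"
  shows adapted_w: "w t \<in> borel_measurable (past t i)"
    and adapted_m: "m t \<in> borel_measurable (past t i)"
    and adapted_u: "i \<le> S \<Longrightarrow> u k t i \<in> borel_measurable (past t i)"
  using params_adapted[of t] local_models_adapted[OF assms, of i k] assms
    past_mono[of t t 0 i borel] by auto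

section \<open>Noise and drift of the local steps\<close>

definition noise :: "'k \<Rightarrow> nat \<Rightarrow> nat \<Rightarrow> 'a \<Rightarrow> real ^ 'd" where
  "noise k t i \<omega> = (G k (u k t i \<omega>) (\<xi> k t i \<omega>) - gradient (f_loc k) (u k t i \<omega>)) * m t \<omega>"

text \<open>The conditional mean of the masked stochastic gradient given the past;
  \<open>noise\<close> is the centred rest. Both carry the mask, so both stay in its
  coordinates.\<close>

definition drift :: "'k \<Rightarrow> nat \<Rightarrow> nat \<Rightarrow> 'a \<Rightarrow> real ^ 'd" where
  "drift k t i \<omega> = gradient (f_loc k) (u k t i \<omega>) * m t \<omega>"

definition masked_gradient :: "nat \<Rightarrow> 'a \<Rightarrow> real ^ 'd" where
  "masked_gradient t \<omega> = m t \<omega> * gradient f (w t \<omega>)"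

definition aggregate :: "nat \<Rightarrow> 'a \<Rightarrow> real ^ 'd" where
  "aggregate t \<omega> = client_avg (\<lambda>k. u k t S \<omega>)"

lemma mem_I: "t \<in> {1..T} \<Longrightarrow> i < S \<Longrightarrow> (k, t, i) \<in> I"
  by (auto simp: I_def)

lemma local_model_eq:
  assumes "\<omega> \<in> space M" "t \<in> {1..T}"
  shows "i \<le> S \<Longrightarrow> u k t i \<omega> = w t \<omega> - \<eta> *\<^sub>R (\<Sum>j<i. noise k t j \<omega> + drift k t j \<omega>)"
proof (induction i)
  case (Suc i)
  have "G k (u k t i \<omega>) (\<xi> k t i \<omega>) * m t \<omega> = noise k t i \<omega> + drift k t i \<omega>"
    by (simp add: noise_def drift_def algebra_simps)
  then have "u k t (Suc i) \<omega> = u k t i \<omega> - \<eta> *\<^sub>R (noise k t i \<omega> + drift k t i \<omega>)"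
    using Suc.prems assms by (simp add: local_step)
  then show ?case
    using Suc by (simp add: scaleR_add_right)
qed (simp add: local_init[OF assms])

lemma
  assumes t: "t \<in> {1..T}" and i: "i < S"
  shows noise_adapted: "noise k t i \<in> borel_measurable (past t (Suc i))"
    and drift_adapted: "drift k t i \<in> borel_measurable (past t i)"
proof -
  have [measurable]: "u k t i \<in> borel_measurable (past t (Suc i))"
    "m t \<in> borel_measurable (past t (Suc i))"
    using adapted_u[OF t, of i k] adapted_m[OF t, of "Suc i"] i past_mono[of t t i "Suc i" borel]
    by auto
  have [measurable]: "\<xi> k t i \<in> measurable (past t (Suc i)) (D k)"
    using mem_I[OF t i] by (intro sample_measurable_past) auto
  note [measurable] = oracle_measurable[of k]
  show "noise k t i \<in> borel_measurable (past t (Suc i))"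
    unfolding noise_def by measurable
  have [measurable]: "u k t i \<in> borel_measurable (past t i)" "m t \<in> borel_measurable (past t i)"
    using adapted_u[OF t, of i k] adapted_m[OF t, of i] i by auto
  show "drift k t i \<in> borel_measurable (past t i)"
    unfolding drift_def by measurable
qed

lemma masked_gradient_adapted:
  assumes "t \<in> {1..T}"
  shows "masked_gradient t \<in> borel_measurable (past t i)"
proof -
  note [measurable] = adapted_w[OF assms, of i] adapted_m[OF assms, of i]
  show ?thesis
    unfolding masked_gradient_def by measurable
qed

text \<open>Integrability is not known in advance, so the past is frozen in ennreal: at each fixed
  model the variance hypothesis applies, and masking only shortens vectors.\<close>

lemma
  assumes t: "t \<in> {1..T}" and i: "i < S"
  shows noise_square_integrable: "square_integrable (noise k t i)"
    and noise_variance: "(\<integral>\<omega>. (norm (noise k t i \<omega>))\<^sup>2 \<partial>M) \<le> \<sigma>\<^sup>2"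
proof -
  note [measurable] = oracle_measurable[of k]
  have [measurable]: "u k t i \<in> borel_measurable (past t i)" "m t \<in> borel_measurable (past t i)"
    using adapted_u[OF t, of i k] adapted_m[OF t, of i] i by auto
  have [measurable]: "noise k t i \<in> borel_measurable M"
    using noise_adapted[OF t i] past_measurable by blast
  define h where "h \<omega> z = (norm ((G k (u k t i \<omega>) z - gradient (f_loc k) (u k t i \<omega>)) * m t \<omega>))\<^sup>2"
    for \<omega> z
  have h: "(\<lambda>(\<omega>, z). h \<omega> z) \<in> borel_measurable (past t i \<Otimes>\<^sub>M D k)"
    unfolding h_def by measurable
  have "(\<integral>\<^sup>+z. ennreal (h \<omega> z) \<partial>D k) \<le> ennreal (\<sigma>\<^sup>2)" if \<omega>: "\<omega> \<in> space M" for \<omega>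
  proof -
    have "(\<integral>\<^sup>+z. ennreal (h \<omega> z) \<partial>D k)
        \<le> (\<integral>\<^sup>+z. ennreal ((norm (G k (u k t i \<omega>) z - gradient (f_loc k) (u k t i \<omega>)))\<^sup>2) \<partial>D k)"
      unfolding h_def using mask_01[OF \<omega>] t
      by (intro nn_integral_mono ennreal_leI power_mono norm_mult_mask_le) auto
    also have "\<dots> = ennreal (\<integral>z. (norm (G k (u k t i \<omega>) z - gradient (f_loc k) (u k t i \<omega>)))\<^sup>2 \<partial>D k)"
      by (intro nn_integral_eq_integral variance) simp
    also have "\<dots> \<le> ennreal (\<sigma>\<^sup>2)"
      by (intro ennreal_leI variance)
    finally show ?thesis .
  qed
  then have "(\<integral>\<^sup>+\<omega>. (\<integral>\<^sup>+z. ennreal (h \<omega> z) \<partial>D k) \<partial>M) \<le> (\<integral>\<^sup>+\<omega>. ennreal (\<sigma>\<^sup>2) \<partial>M)"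
    by (intro nn_integral_mono)
  also have "(\<integral>\<^sup>+\<omega>. (\<integral>\<^sup>+z. ennreal (h \<omega> z) \<partial>D k) \<partial>M) = (\<integral>\<^sup>+\<omega>. ennreal (h \<omega> (\<xi> k t i \<omega>)) \<partial>M)"
    by (rule nn_integral_independent[symmetric, OF _ _ _ past_indep h])
      (use mem_I[OF t i] in \<open>auto intro: sample_measurable samples\<close>)
  finally have le: "(\<integral>\<^sup>+\<omega>. ennreal ((norm (noise k t i \<omega>))\<^sup>2) \<partial>M) \<le> ennreal (\<sigma>\<^sup>2)"
    by (simp add: h_def noise_def emeasure_space_1)
  then have "integrable M (\<lambda>\<omega>. (norm (noise k t i \<omega>))\<^sup>2)"
    by (intro integrableI_nonneg) (auto intro: le_less_trans[OF _ ennreal_less_top])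
  then show "square_integrable (noise k t i)"
    by (simp add: square_integrable_def)
  show "(\<integral>\<omega>. (norm (noise k t i \<omega>))\<^sup>2 \<partial>M) \<le> \<sigma>\<^sup>2"
    by (rule integral_real_bounded[OF _ le]) simp
qed

text \<open>With the past frozen, unbiasedness makes the integral over the sample zero at every
  outcome. The mask is moved onto \<open>Z\<close>, so that the bare fluctuation of the stochastic
  gradient is what gets integrated.\<close>

lemma noise_orthogonal:
  assumes t: "t \<in> {1..T}" and i: "i < S"
    and Z: "Z \<in> borel_measurable (past t i)" "square_integrable Z"
  shows "(\<integral>\<omega>. inner (noise k t i \<omega>) (Z \<omega>) \<partial>M) = 0"
proof -
  interpret Dk: prob_space "D k"
    by (rule sample_dist)
  note [measurable] = oracle_measurable[of k] Z(1)
  have [measurable]: "u k t i \<in> borel_measurable (past t i)" "m t \<in> borel_measurable (past t i)"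
    using adapted_u[OF t, of i k] adapted_m[OF t, of i] i by auto
  define h where "h \<omega> z = inner (G k (u k t i \<omega>) z - gradient (f_loc k) (u k t i \<omega>)) (Z \<omega> * m t \<omega>)"
    for \<omega> z
  have eq: "h \<omega> (\<xi> k t i \<omega>) = inner (noise k t i \<omega>) (Z \<omega>)" for \<omega>
    by (simp add: h_def noise_def inner_mult_vec)
  have h: "(\<lambda>(\<omega>, z). h \<omega> z) \<in> borel_measurable (past t i \<Otimes>\<^sub>M D k)"
    unfolding h_def by measurable
  have zero: "(\<integral>z. h \<omega> z \<partial>D k) = 0" for \<omega>
    unfolding h_def using unbiased by (simp add: Dk.prob_space)
  have "(\<integral>\<omega>. h \<omega> (\<xi> k t i \<omega>) \<partial>M) = (\<integral>\<omega>. (\<integral>z. h \<omega> z \<partial>D k) \<partial>M)"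
  proof (rule integral_independent[OF _ _ _ past_indep h])
    show "integrable M (\<lambda>\<omega>. h \<omega> (\<xi> k t i \<omega>))"
      unfolding eq by (intro square_integrable_inner noise_square_integrable t i Z)
  qed (use mem_I[OF t i] in \<open>auto intro: sample_measurable samples\<close>)
  then show ?thesis
    by (simp add: eq zero)
qed

lemma drift_bound:
  assumes "\<omega> \<in> space M" "t \<in> {1..T}"
  shows "norm (drift k t i \<omega>) \<le> L\<^sub>p + \<bar>\<epsilon>\<bar>"
proof -
  have "norm (drift k t i \<omega>) \<le> norm (gradient (f_loc k) (u k t i \<omega>))"
    unfolding drift_def using mask_01[OF assms(1)] assms(2) by (intro norm_mult_mask_le) auto
  then show ?thesis
    using norm_gradient_local_le order_trans by blast
qed

lemma drift_square_integrable:
  assumes "t \<in> {1..T}" "i < S"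
  shows "square_integrable (drift k t i)"
  using assms drift_adapted past_measurable drift_bound
  by (intro square_integrable_bounded) blast+

lemma masked_gradient_square_integrable:
  assumes "t \<in> {1..T}"
  shows "square_integrable (masked_gradient t)"
proof (rule square_integrable_bounded)
  show "masked_gradient t \<in> borel_measurable M"
    using masked_gradient_adapted[OF assms] past_measurable by blast
  fix \<omega> assume \<omega>: "\<omega> \<in> space M"
  have "norm (masked_gradient t \<omega>) \<le> norm (gradient f (w t \<omega>))"
    unfolding masked_gradient_def mult.commute[of "m t \<omega>"]
    using mask_01[OF \<omega>] assms by (intro norm_mult_mask_le) auto
  then show "norm (masked_gradient t \<omega>) \<le> L\<^sub>p"
    using norm_gradient_global_le order_trans by blast
qed

lemma noise_sum_square_integrable:
  assumes "t \<in> {1..T}" "i \<le> S"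
  shows "square_integrable (\<lambda>\<omega>. \<Sum>j<i. noise k t j \<omega>)"
  using assms by (intro square_integrable_sum noise_square_integrable) auto

text \<open>The noise terms of a client are martingale differences: the sum of the earlier ones is
  known before step i, so cross terms vanish and variances add, to i sigma^2 and not i^2
  sigma^2.\<close>

lemma noise_sum_variance:
  assumes t: "t \<in> {1..T}"
  shows "i \<le> S \<Longrightarrow> (\<integral>\<omega>. (norm (\<Sum>j<i. noise k t j \<omega>))\<^sup>2 \<partial>M) \<le> real i * \<sigma>\<^sup>2"
proof (induction i)
  case (Suc i)
  define N where "N \<omega> = (\<Sum>j<i. noise k t j \<omega>)" for \<omega>
  have sq: "square_integrable N" "square_integrable (noise k t i)"
    using Suc noise_sum_square_integrable[OF t, of i k] noise_square_integrable[OF t, of i k]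
    by (auto simp: N_def[abs_def])
  have meas: "noise k t j \<in> borel_measurable (past t i)" if "j < i" for j
    using noise_adapted[OF t, of j k] past_mono[of t t "Suc j" i borel] that Suc by auto
  have N: "N \<in> borel_measurable (past t i)"
    unfolding N_def by (intro borel_measurable_sum meas) simp
  have int: "integrable M (\<lambda>\<omega>. inner (noise k t i \<omega>) (N \<omega>))"
    "integrable M (\<lambda>\<omega>. (norm (N \<omega>))\<^sup>2)" "integrable M (\<lambda>\<omega>. (norm (noise k t i \<omega>))\<^sup>2)"
    using sq square_integrable_inner[OF sq(2,1)] by (auto simp: square_integrable_def)
  have "(\<integral>\<omega>. (norm (\<Sum>j<Suc i. noise k t j \<omega>))\<^sup>2 \<partial>M)
      = (\<integral>\<omega>. (norm (N \<omega>))\<^sup>2 + 2 * inner (noise k t i \<omega>) (N \<omega>) + (norm (noise k t i \<omega>))\<^sup>2 \<partial>M)"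
    by (intro Bochner_Integration.integral_cong refl)
      (simp add: N_def power2_norm_eq_inner inner_add_left inner_add_right inner_commute)
  also have "\<dots> = (\<integral>\<omega>. (norm (N \<omega>))\<^sup>2 \<partial>M) + (\<integral>\<omega>. (norm (noise k t i \<omega>))\<^sup>2 \<partial>M)"
    using Suc int by (simp add: noise_orthogonal[OF t _ N sq(1)])
  also have "\<dots> \<le> real i * \<sigma>\<^sup>2 + \<sigma>\<^sup>2"
    using Suc noise_variance[OF t, of i k] by (intro add_mono) (auto simp: N_def)
  finally show ?case
    by (simp add: algebra_simps)
qed simp

section \<open>Integrability, and expected descent of one round\<close>

lemma params_integrable:
  shows "t \<in> {1..Suc T} \<Longrightarrow> integrable M (w t)"
    and aggregate_integrable: "t \<in> {1..T} \<Longrightarrow> integrable M (aggregate t)"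
proof -
  \<comment> \<open>Only first moments propagate from round to round, because \<open>w 1\<close> is
    just integrable; the increments are square integrable.\<close>
  have agg: "integrable M (aggregate t)" if t: "t \<in> {1..T}" and w: "integrable M (w t)" for t
  proof -
    have "integrable M (\<lambda>\<omega>. w t \<omega> - \<eta> *\<^sub>R (\<Sum>j<S. noise k t j \<omega> + drift k t j \<omega>))" for k
      using t by (intro Bochner_Integration.integrable_diff w square_integrable_imp_integrable
        square_integrable_scaleR square_integrable_sum square_integrable_add
        noise_square_integrable drift_square_integrable) auto
    moreover have "integrable M (u k t S) \<longleftrightarrow>
        integrable M (\<lambda>\<omega>. w t \<omega> - \<eta> *\<^sub>R (\<Sum>j<S. noise k t j \<omega> + drift k t j \<omega>))" for k
      by (intro Bochner_Integration.integrable_cong refl local_model_eq t) auto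
    ultimately have "integrable M (u k t S)" for k
      by blast
    then show ?thesis
      unfolding aggregate_def client_avg_def by simp
  qed
  have "integrable M (w t)" if "t \<in> {1..Suc T}" for t
    using that
  proof (induction t rule: nat_induct)
    case (Suc t)
    show ?case
    proof (cases "t = 0")
      case True
      then show ?thesis
        using init by simp
    next
      case False
      then have t: "t \<in> {1..T}"
        using Suc by auto
      then have int: "integrable M (aggregate t)"
        using Suc by (intro agg) auto
      show ?thesis
      proof (rule Bochner_Integration.integrable_bound[OF int])
        show "w (Suc t) \<in> borel_measurable M"
          using params_adapted[of "Suc t"] past_measurable t by auto
        show "AE \<omega> in M. norm (w (Suc t) \<omega>) \<le> norm (aggregate t \<omega>)"
        proof (rule AE_I2)
          fix \<omega> assume \<omega>: "\<omega> \<in> space M"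
          show "norm (w (Suc t) \<omega>) \<le> norm (aggregate t \<omega>)"
            unfolding aggregate_def server_update[OF \<omega> t]
            using mask_01[OF \<omega>, of "Suc t"] t by (intro norm_mult_mask_le) auto
        qed
      qed
    qed
  qed simp
  then show "t \<in> {1..Suc T} \<Longrightarrow> integrable M (w t)"
    "t \<in> {1..T} \<Longrightarrow> integrable M (aggregate t)"
    using agg by auto
qed

text \<open>A Lipschitz function grows at most linearly.\<close>

lemma integrable_f:
  assumes "integrable M X"
  shows "integrable M (\<lambda>\<omega>. f (X \<omega>))"
proof (rule Bochner_Integration.integrable_bound)
  show "integrable M (\<lambda>\<omega>. \<bar>f 0\<bar> + L\<^sub>p * norm (X \<omega>))"
    using assms by simp
  have [measurable]: "X \<in> borel_measurable M"
    using assms by simp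
  show "(\<lambda>\<omega>. f (X \<omega>)) \<in> borel_measurable M"
    by measurable
  have "\<bar>f x\<bar> \<le> \<bar>f 0\<bar> + L\<^sub>p * norm x" for x
    using lipschitz[of x 0] by simp
  then show "AE \<omega> in M. norm (f (X \<omega>)) \<le> norm (\<bar>f 0\<bar> + L\<^sub>p * norm (X \<omega>))"
    using L\<^sub>p_nonneg by simp
qed

lemma expected_round_descent:
  assumes t: "t \<in> {1..T}"
  shows "(\<integral>\<omega>. f (aggregate t \<omega>) \<partial>M) \<le> (\<integral>\<omega>. f (w t \<omega>) \<partial>M)
    - \<eta> * real S / 4 * (\<integral>\<omega>. (norm (masked_gradient t \<omega>))\<^sup>2 \<partial>M)
    + 2 * L\<^sup>2 * \<eta> ^ 3 * (real S)\<^sup>2 * \<sigma>\<^sup>2 + L * \<eta>\<^sup>2 / 2 * real S * \<sigma>\<^sup>2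
    + 8 * \<eta> ^ 3 * L\<^sup>2 * real S ^ 3 * \<epsilon>\<^sup>2"
proof -
  define Q where "Q i \<omega> = client_avg (\<lambda>k. (norm (\<Sum>j<i. noise k t j \<omega>))\<^sup>2)" for i \<omega>
  define b where "b j \<omega> = client_avg (\<lambda>k. drift k t j \<omega>)" for j \<omega>
  define Z where "Z i \<omega> = (L * \<eta>\<^sup>2) *\<^sub>R (\<Sum>j<S. if j \<le> i then b j \<omega> else masked_gradient t \<omega>)
    - \<eta> *\<^sub>R masked_gradient t \<omega>" for i \<omega>
  define X where "X i \<omega> = inner (client_avg (\<lambda>k. noise k t i \<omega>)) (Z i \<omega>)" for i \<omega>
  define c where "c = 8 * \<eta> ^ 3 * L\<^sup>2 * real S ^ 3 * \<epsilon>\<^sup>2"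
  have small: "32 * (\<eta> * L * real S)\<^sup>2 \<le> 1"
    by (rule step_size_sq[OF L_pos step_size(1) S_pos step_size(2)])
  have pointwise: "f (aggregate t \<omega>) \<le> f (w t \<omega>) - \<eta> * real S / 4 * (norm (masked_gradient t \<omega>))\<^sup>2
      + 4 * L\<^sup>2 * \<eta> ^ 3 * (\<Sum>i<S. Q i \<omega>) + L * \<eta>\<^sup>2 / 2 * Q S \<omega> + c + (\<Sum>i<S. X i \<omega>)"
    if \<omega>: "\<omega> \<in> space M" for \<omega>
    unfolding Q_def X_def Z_def b_def c_def
  proof (rule round_descent[OF L_pos step_size(1) S_pos small])
    have mask: "m t \<omega> $ j \<in> {0, 1}" for j
      using mask_01[OF \<omega>] t by auto
    show "u k t i \<omega> = w t \<omega> - \<eta> *\<^sub>R (\<Sum>j<i. noise k t j \<omega> + drift k t j \<omega>)" if "i \<le> S" for k i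
      using local_model_eq[OF \<omega> t that] .
    have drift0: "drift k t 0 \<omega> = gradient (f_loc k) (w t \<omega>) * m t \<omega>" for k
      by (simp add: drift_def local_init[OF \<omega> t])
    have diff: "norm (x * m t \<omega> - y * m t \<omega>) \<le> norm (x - y)" for x y :: "real ^ 'd"
      using norm_mult_mask_le[OF mask, of "x - y"] by (simp add: algebra_simps)
    show "norm (drift k t i \<omega> - drift k t 0 \<omega>) \<le> L * norm (u k t i \<omega> - w t \<omega>)" for k i
      unfolding drift0 unfolding drift_def by (rule order_trans[OF diff smooth])
    show a: "client_avg (\<lambda>k. drift k t 0 \<omega>) = masked_gradient t \<omega>"
      unfolding drift0 masked_gradient_def gradient_global
      by (simp add: client_avg_def vec_eq_iff sum_distrib_left mult_ac)
    show "(norm (drift k t 0 \<omega> - masked_gradient t \<omega>))\<^sup>2 \<le> \<epsilon>\<^sup>2" for k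
    proof -
      have "norm (drift k t 0 \<omega> - masked_gradient t \<omega>)
          \<le> norm (gradient (f_loc k) (w t \<omega>) - gradient f (w t \<omega>))"
        unfolding drift0 masked_gradient_def mult.commute[of "m t \<omega>" "gradient f (w t \<omega>)"]
        by (rule diff)
      then have "(norm (drift k t 0 \<omega> - masked_gradient t \<omega>))\<^sup>2
          \<le> (norm (gradient f (w t \<omega>) - gradient (f_loc k) (w t \<omega>)))\<^sup>2"
        by (intro power_mono) (auto simp: norm_minus_commute)
      then show ?thesis
        using deviation order_trans by blast
    qed
    show "f (aggregate t \<omega>) \<le> f (w t \<omega>)
        + inner (gradient f (w t \<omega>)) (client_avg (\<lambda>k. u k t S \<omega>) - w t \<omega>)
        + L / 2 * (norm (client_avg (\<lambda>k. u k t S \<omega>) - w t \<omega>))\<^sup>2"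
      unfolding aggregate_def using GDERIV_global smooth_global
      by (intro smooth_descent) (auto simp: gradient_global)
    \<comment> \<open>Masking is an orthogonal projection and \<open>x * m t \<omega>\<close> lies
      in its range, so projecting the other factor as well changes nothing.\<close>
    have in_mask: "inner (gradient f (w t \<omega>)) (x * m t \<omega>) = inner (masked_gradient t \<omega>) (x * m t \<omega>)"
      for x
      unfolding masked_gradient_def mult.commute[of "m t \<omega>" "gradient f (w t \<omega>)"] inner_mult_vec
      by (simp add: mult.assoc mask_mult_self[OF mask])
    show "inner (gradient f (w t \<omega>)) (noise k t i \<omega>) = inner (masked_gradient t \<omega>) (noise k t i \<omega>)"
      "inner (gradient f (w t \<omega>)) (drift k t i \<omega>) = inner (masked_gradient t \<omega>) (drift k t i \<omega>)"
      for k i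
      unfolding noise_def drift_def by (rule in_mask)+
  qed
  have Zsq: "square_integrable (Z i)" if "i < S" for i
  proof -
    have "square_integrable (\<lambda>\<omega>. if j \<le> i then b j \<omega> else masked_gradient t \<omega>)" if "j < S" for j
      using that t drift_square_integrable[OF t that] masked_gradient_square_integrable[OF t]
      by (cases "j \<le> i") (auto simp: b_def intro!: square_integrable_client_avg)
    then have "square_integrable (\<lambda>\<omega>. (L * \<eta>\<^sup>2) *\<^sub>R
        (\<Sum>j<S. if j \<le> i then b j \<omega> else masked_gradient t \<omega>) + (- \<eta>) *\<^sub>R masked_gradient t \<omega>)"
      using t by (intro square_integrable_add square_integrable_scaleR square_integrable_sum
        masked_gradient_square_integrable) auto
    then show ?thesis
      by (simp add: Z_def[abs_def])
  qed
  \<comment> \<open>The case distinction in \<open>Z\<close> is made for this: for j > i the drift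
    may depend on sample i, and \<open>masked_gradient\<close>, known since the start of the round,
    takes its place.\<close>
  have Zpast: "Z i \<in> borel_measurable (past t i)" if "i < S" for i
  proof -
    have "(\<lambda>\<omega>. if j \<le> i then b j \<omega> else masked_gradient t \<omega>) \<in> borel_measurable (past t i)"
      if "j < S" for j
    proof (cases "j \<le> i")
      case True
      then have [measurable]: "drift k t j \<in> borel_measurable (past t i)" for k
        using drift_adapted[OF t that, of k] past_mono[of t t j i borel] by auto
      show ?thesis
        using True unfolding b_def by simp
    qed (simp add: masked_gradient_adapted[OF t])
    then show ?thesis
      using masked_gradient_adapted[OF t, of i] unfolding Z_def
      by (intro borel_measurable_diff borel_measurable_scaleR borel_measurable_const
        borel_measurable_sum) auto
  qed
  have X_avg: "X i \<omega> = client_avg (\<lambda>k. inner (noise k t i \<omega>) (Z i \<omega>))" for i \<omega>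
    unfolding X_def by (subst inner_commute) (simp add: client_avg_inner inner_commute)
  have X: "integrable M (X i)" "(\<integral>\<omega>. X i \<omega> \<partial>M) = 0" if i: "i < S" for i
  proof -
    have int: "integrable M (\<lambda>\<omega>. inner (noise k t i \<omega>) (Z i \<omega>))" for k
      by (intro square_integrable_inner noise_square_integrable t i Zsq)
    then show "integrable M (X i)"
      unfolding X_avg client_avg_def by simp
    show "(\<integral>\<omega>. X i \<omega> \<partial>M) = 0"
      unfolding X_avg client_avg_def
      using int noise_orthogonal[OF t i Zpast[OF i] Zsq[OF i]] by simp
  qed
  have Q: "integrable M (Q i)" "(\<integral>\<omega>. Q i \<omega> \<partial>M) \<le> real i * \<sigma>\<^sup>2" if i: "i \<le> S" for i
  proof -
    have int: "integrable M (\<lambda>\<omega>. (norm (\<Sum>j<i. noise k t j \<omega>))\<^sup>2)" for k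
      using noise_sum_square_integrable[OF t i] by (simp add: square_integrable_def)
    then show "integrable M (Q i)"
      unfolding Q_def client_avg_def by simp
    have "(\<integral>\<omega>. Q i \<omega> \<partial>M) = client_avg (\<lambda>k. \<integral>\<omega>. (norm (\<Sum>j<i. noise k t j \<omega>))\<^sup>2 \<partial>M)"
      unfolding Q_def client_avg_def using int by simp
    also have "\<dots> \<le> client_avg (\<lambda>k::'k. real i * \<sigma>\<^sup>2)"
      by (intro client_avg_mono noise_sum_variance t i)
    finally show "(\<integral>\<omega>. Q i \<omega> \<partial>M) \<le> real i * \<sigma>\<^sup>2"
      by simp
  qed
  have a: "integrable M (\<lambda>\<omega>. (norm (masked_gradient t \<omega>))\<^sup>2)"
    using masked_gradient_square_integrable[OF t] by (simp add: square_integrable_def)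
  have fw: "integrable M (\<lambda>\<omega>. f (w t \<omega>))"
    using t by (intro integrable_f params_integrable) auto
  have sums: "integrable M (\<lambda>\<omega>. \<Sum>i<S. Q i \<omega>)" "integrable M (\<lambda>\<omega>. \<Sum>i<S. X i \<omega>)"
    using Q X by (auto intro!: Bochner_Integration.integrable_sum)
  have "(\<integral>\<omega>. f (aggregate t \<omega>) \<partial>M) \<le> (\<integral>\<omega>. f (w t \<omega>)
      - \<eta> * real S / 4 * (norm (masked_gradient t \<omega>))\<^sup>2
      + 4 * L\<^sup>2 * \<eta> ^ 3 * (\<Sum>i<S. Q i \<omega>) + L * \<eta>\<^sup>2 / 2 * Q S \<omega> + c + (\<Sum>i<S. X i \<omega>) \<partial>M)"
  proof (rule integral_mono)
    show "integrable M (\<lambda>\<omega>. f (aggregate t \<omega>))"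
      by (intro integrable_f aggregate_integrable t)
  qed (use a fw sums Q(1)[of S] pointwise in simp_all)
  also have "\<dots> = (\<integral>\<omega>. f (w t \<omega>) \<partial>M) - \<eta> * real S / 4 * (\<integral>\<omega>. (norm (masked_gradient t \<omega>))\<^sup>2 \<partial>M)
      + 4 * L\<^sup>2 * \<eta> ^ 3 * (\<integral>\<omega>. (\<Sum>i<S. Q i \<omega>) \<partial>M) + L * \<eta>\<^sup>2 / 2 * (\<integral>\<omega>. Q S \<omega> \<partial>M) + c
      + (\<integral>\<omega>. (\<Sum>i<S. X i \<omega>) \<partial>M)"
    using a fw sums Q(1)[of S] by (simp add: prob_space)
  also have "(\<integral>\<omega>. (\<Sum>i<S. X i \<omega>) \<partial>M) = 0"
    using X by (subst Bochner_Integration.integral_sum) auto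
  \<comment> \<open>The variances of the partial sums add up to S (S - 1) / 2 times sigma^2, rounded
    up to S^2 / 2; this halves the coefficient 4 to the 2 of the statement.\<close>
  also have "4 * L\<^sup>2 * \<eta> ^ 3 * (\<integral>\<omega>. (\<Sum>i<S. Q i \<omega>) \<partial>M) \<le> 4 * L\<^sup>2 * \<eta> ^ 3 * ((real S)\<^sup>2 / 2 * \<sigma>\<^sup>2)"
  proof (rule mult_left_mono)
    have "(\<integral>\<omega>. (\<Sum>i<S. Q i \<omega>) \<partial>M) = (\<Sum>i<S. \<integral>\<omega>. Q i \<omega> \<partial>M)"
      using Q by (intro Bochner_Integration.integral_sum) auto
    also have "\<dots> \<le> (\<Sum>i<S. real i * \<sigma>\<^sup>2)"
      using Q by (intro sum_mono) auto
    also have "\<dots> = (\<Sum>i<S. real i) * \<sigma>\<^sup>2"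
      by (simp add: sum_distrib_right)
    also have "(\<Sum>i<n. real i) \<le> (real n)\<^sup>2 / 2" for n
      by (induction n) (auto simp: power2_eq_square field_simps)
    then have "(\<Sum>i<S. real i) * \<sigma>\<^sup>2 \<le> (real S)\<^sup>2 / 2 * \<sigma>\<^sup>2"
      by (intro mult_right_mono) auto
    finally show "(\<integral>\<omega>. (\<Sum>i<S. Q i \<omega>) \<partial>M) \<le> (real S)\<^sup>2 / 2 * \<sigma>\<^sup>2" .
  qed (use step_size in simp)
  also have "L * \<eta>\<^sup>2 / 2 * (\<integral>\<omega>. Q S \<omega> \<partial>M) \<le> L * \<eta>\<^sup>2 / 2 * (real S * \<sigma>\<^sup>2)"
    using L_pos by (intro mult_left_mono Q) auto
  finally show ?thesis
    by (simp add: c_def mult_ac)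
qed

section \<open>Summation over the rounds, and the final sparsity\<close>

lemma average_gradient_bound:
  assumes T: "T > 0" and opt: "AE \<omega> in M. f_opt \<le> f (w (Suc T) \<omega>)"
  shows "(\<integral>\<omega>. (1 / real T) * (\<Sum>t=1..T. (norm (m t \<omega> * gradient f (w t \<omega>)))\<^sup>2) \<partial>M)
     \<le> 2 * \<eta> * L * ((1 + 4 * L * \<eta> * real S) * \<sigma>\<^sup>2 + (16 * L * \<eta> * (real S)\<^sup>2) * \<epsilon>\<^sup>2)
       + 4 / (real T * \<eta> * real S) * (\<integral>\<omega>. f (w 1 \<omega>) - f_opt \<partial>M)
       + 4 / (real T * \<eta> * real S) *
           (\<Sum>t=1..T. L\<^sub>p * (\<integral>\<omega>. norm (w (t + 1) \<omega> - aggregate t \<omega>) \<partial>M))"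
proof -
  define A where "A t = (\<integral>\<omega>. (norm (masked_gradient t \<omega>))\<^sup>2 \<partial>M)" for t
  define E where "E t = (\<integral>\<omega>. f (w t \<omega>) \<partial>M)" for t
  define P where "P t = (\<integral>\<omega>. norm (w (t + 1) \<omega> - aggregate t \<omega>) \<partial>M)" for t
  define R where "R = 2 * L\<^sup>2 * \<eta> ^ 3 * (real S)\<^sup>2 * \<sigma>\<^sup>2 + L * \<eta>\<^sup>2 / 2 * real S * \<sigma>\<^sup>2
    + 8 * \<eta> ^ 3 * L\<^sup>2 * real S ^ 3 * \<epsilon>\<^sup>2"
  have step: "\<eta> * real S / 4 * A t \<le> E t - E (Suc t) + L\<^sub>p * P t + R" if t: "t \<in> {1..T}" for t
  proof -
    have int: "integrable M (w (Suc t))" "integrable M (aggregate t)"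
      using t by (auto intro!: params_integrable aggregate_integrable)
    have "E (Suc t) \<le> (\<integral>\<omega>. f (aggregate t \<omega>) + L\<^sub>p * norm (w (Suc t) \<omega> - aggregate t \<omega>) \<partial>M)"
      unfolding E_def
    proof (rule integral_mono)
      show "integrable M (\<lambda>\<omega>. f (w (Suc t) \<omega>))"
        by (intro integrable_f int)
      show "integrable M (\<lambda>\<omega>. f (aggregate t \<omega>) + L\<^sub>p * norm (w (Suc t) \<omega> - aggregate t \<omega>))"
        using integrable_f[OF int(2)] int by simp
      show "f (w (Suc t) \<omega>) \<le> f (aggregate t \<omega>) + L\<^sub>p * norm (w (Suc t) \<omega> - aggregate t \<omega>)" for \<omega>
        using lipschitz[of "w (Suc t) \<omega>" "aggregate t \<omega>"] by simp
    qed
    also have "\<dots> = (\<integral>\<omega>. f (aggregate t \<omega>) \<partial>M) + L\<^sub>p * P t"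
      unfolding P_def using integrable_f[OF int(2)] int by simp
    finally show ?thesis
      using expected_round_descent[OF t] unfolding A_def E_def R_def by linarith
  qed
  have "(\<Sum>t=1..T. E t - E (Suc t)) = E 1 - E (Suc T)"
    using sum_Suc_diff[of 1 T "\<lambda>t. - E t"] T by simp
  then have "(\<Sum>t=1..T. E t - E (Suc t) + L\<^sub>p * P t + R)
      = E 1 - E (Suc T) + (\<Sum>t=1..T. L\<^sub>p * P t) + real T * R"
    by (simp add: sum.distrib)
  moreover have "(\<Sum>t=1..T. \<eta> * real S / 4 * A t) \<le> (\<Sum>t=1..T. E t - E (Suc t) + L\<^sub>p * P t + R)"
    by (intro sum_mono step)
  ultimately have sum: "\<eta> * real S / 4 * (\<Sum>t=1..T. A t)
      \<le> E 1 - E (Suc T) + (\<Sum>t=1..T. L\<^sub>p * P t) + real T * R"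
    by (simp add: sum_distrib_left)
  have "(\<integral>\<omega>. f_opt \<partial>M) \<le> E (Suc T)"
    unfolding E_def using opt by (intro integral_mono_AE integrable_f params_integrable) auto
  then have "f_opt \<le> E (Suc T)"
    by (simp add: prob_space)
  moreover have "(\<integral>\<omega>. f (w 1 \<omega>) - f_opt \<partial>M) = E 1 - f_opt"
    using integrable_f[OF init(1)] by (simp add: E_def prob_space)
  ultimately have sum': "\<eta> * real S / 4 * (\<Sum>t=1..T. A t)
      \<le> (\<integral>\<omega>. f (w 1 \<omega>) - f_opt \<partial>M) + (\<Sum>t=1..T. L\<^sub>p * P t) + real T * R"
    using sum by simp
  have int: "integrable M (\<lambda>\<omega>. (norm (masked_gradient t \<omega>))\<^sup>2)" if "t \<in> {1..T}" for t
    using masked_gradient_square_integrable[OF that] by (simp add: square_integrable_def)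
  have "(\<integral>\<omega>. (1 / real T) * (\<Sum>t=1..T. (norm (m t \<omega> * gradient f (w t \<omega>)))\<^sup>2) \<partial>M)
      = (1 / real T) * (\<Sum>t=1..T. A t)"
    unfolding masked_gradient_def[symmetric] A_def
    using int by (subst Bochner_Integration.integral_mult_right_zero,
      subst Bochner_Integration.integral_sum) auto
  also have "\<dots> = 4 / (real T * \<eta> * real S) * (\<eta> * real S / 4 * (\<Sum>t=1..T. A t))"
    using step_size S_pos by simp
  also have "\<dots> \<le> 4 / (real T * \<eta> * real S) *
      ((\<integral>\<omega>. f (w 1 \<omega>) - f_opt \<partial>M) + (\<Sum>t=1..T. L\<^sub>p * P t) + real T * R)"
    using step_size by (intro mult_left_mono sum') auto
  also have "\<dots> = 4 / (\<eta> * real S) * R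
      + 4 / (real T * \<eta> * real S) * (\<integral>\<omega>. f (w 1 \<omega>) - f_opt \<partial>M)
      + 4 / (real T * \<eta> * real S) * (\<Sum>t=1..T. L\<^sub>p * P t)"
    using T by (simp add: distrib_left)
  \<comment> \<open>Term by term: 2 L eta sigma^2 belongs to the 1, 8 L^2 eta^2 S sigma^2 to the 4 L
    eta S, and 32 L^2 eta^2 S^2 eps^2 to the 16 L eta S^2.\<close>
  also have "4 / (\<eta> * real S) * R
      = 2 * \<eta> * L * ((1 + 4 * L * \<eta> * real S) * \<sigma>\<^sup>2 + (16 * L * \<eta> * (real S)\<^sup>2) * \<epsilon>\<^sup>2)"
    using step_size S_pos by (simp add: R_def field_simps power2_eq_square power3_eq_cube)
  finally show ?thesis
    by (simp add: P_def)
qed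

text \<open>Each zero of the purging mask is a zero of the new parameters, whatever the old mask
  was. Majority voting has no such guarantee: clients may purge different entries, and the vote can
  then keep them all.\<close>

lemma final_sparsity:
  assumes T: "T > 0" and s: "s T \<le> 1" and "variant = Sparsify_Global" and \<omega>: "\<omega> \<in> space M"
  shows "s T \<le> sparsity (w (Suc T) \<omega>)"
proof -
  have "T \<in> {1..T}"
    using T by simp
  note [simp] = server_update[OF \<omega> this] mask_update[OF \<omega> this]
  have "s T * real CARD('d) \<le> real (card {i. purging_mask (s T) (aggregate T \<omega>) $ i = 0})"
    by (rule sparsity_purging_mask[OF s])
  also have "\<dots> \<le> real (card {i. w (Suc T) \<omega> $ i = 0})"
    by (intro of_nat_mono card_mono) (auto simp: assms(3) aggregate_def)
  finally show ?thesis
    by (simp add: sparsity_def field_simps)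
qed

end

section \<open>The bound\<close>

theorem theorem1:
  fixes f_loc :: "'k::finite \<Rightarrow> real ^ 'd \<Rightarrow> real"
    and f :: "real ^ 'd \<Rightarrow> real"
    and D :: "'k \<Rightarrow> 's measure"
    and G :: "'k \<Rightarrow> real ^ 'd \<Rightarrow> 's \<Rightarrow> real ^ 'd"
    and M :: "'a measure"
    and \<xi> :: "'k \<Rightarrow> nat \<Rightarrow> nat \<Rightarrow> 'a \<Rightarrow> 's"
    and w m :: "nat \<Rightarrow> 'a \<Rightarrow> real ^ 'd"
    and u :: "'k \<Rightarrow> nat \<Rightarrow> nat \<Rightarrow> 'a \<Rightarrow> real ^ 'd"
    and w_opt :: "real ^ 'd"
    and L L\<^sub>p \<sigma> \<epsilon> \<eta> S0 ST n :: real
    and T S F t0 :: nat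
    and variant :: fed_variant
  defines "I \<equiv> (UNIV :: 'k set) \<times> {1..T} \<times> {..<S}"
    and "w_bar \<equiv> \<lambda>t \<omega>. client_avg (\<lambda>k. u k (t - 1) S \<omega>)"
  assumes f_def: "\<And>x. f x = client_avg (\<lambda>k. f_loc k x)"
    and constants: "L > 0" "L\<^sub>p > 0"
    \<comment> \<open>(1) smooth local objectives\<close>
    and differentiable: "\<And>k x. f_loc k differentiable (at x)"
    and smooth: "\<And>k x y. norm (gradient (f_loc k) x - gradient (f_loc k) y) \<le> L * norm (x - y)"
    \<comment> \<open>(2) Lipschitz global objective\<close>
    and lipschitz: "\<And>x y. \<bar>f x - f y\<bar> \<le> L\<^sub>p * norm (x - y)"
    \<comment> \<open>stochastic gradients: functions of the point and of a sample drawn from D k\<close>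
    and sample_dist: "\<And>k. prob_space (D k)"
    and oracle_measurable: "\<And>k. (\<lambda>(x, z). G k x z) \<in> borel_measurable (borel \<Otimes>\<^sub>M D k)"
    \<comment> \<open>(3) unbiased\<close>
    and unbiased: "\<And>k x. integrable (D k) (G k x)"
      "\<And>k x. (\<integral>z. G k x z \<partial>D k) = gradient (f_loc k) x"
    \<comment> \<open>(4) bounded variance\<close>
    and variance: "\<And>k x. integrable (D k) (\<lambda>z. (norm (G k x z - gradient (f_loc k) x))\<^sup>2)"
      "\<And>k x. (\<integral>z. (norm (G k x z - gradient (f_loc k) x))\<^sup>2 \<partial>D k) \<le> \<sigma>\<^sup>2"
    \<comment> \<open>(5) bounded deviation of the clients\<close>
    and deviation: "\<And>k x. (norm (gradient f x - gradient (f_loc k) x))\<^sup>2 \<le> \<epsilon>\<^sup>2"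
    \<comment> \<open>(6), (7) independence over time steps and clients\<close>
    and prob: "prob_space M"
    and samples: "\<And>k t i. (k, t, i) \<in> I \<Longrightarrow> distr M (D k) (\<xi> k t i) = D k"
    and indep: "prob_space.indep_vars M (\<lambda>(k, t, i). D k) (\<lambda>(k, t, i). \<xi> k t i) I"
    \<comment> \<open>initial parameters and mask, chosen before training\<close>
    and init: "integrable M (w 1)" "m 1 \<in> borel_measurable M"
      "\<And>\<omega> j. \<omega> \<in> space M \<Longrightarrow> m 1 \<omega> $ j \<in> {0, 1}"
    and init_indep: "prob_space.indep_set M
        (sets (vimage_algebra (space M) (\<lambda>\<omega>. (w 1 \<omega>, m 1 \<omega>)) (borel \<Otimes>\<^sub>M borel)))
        (sets (vimage_algebra (space M) (\<lambda>\<omega>. \<lambda>(k, t, i)\<in>I. \<xi> k t i \<omega>)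
          (PiM I (\<lambda>(k, t, i). D k))))"
    \<comment> \<open>the algorithm\<close>
    and schedule: "F > 0" "t0 < T" "n > 0"
    and local_steps: "S > 0"
    and step_size: "\<eta> > 0" "\<eta> < 1 / (4 * sqrt 2 * L * real S)"
    and run: "\<And>\<omega>. \<omega> \<in> space M \<Longrightarrow>
        fedsparsify_run variant T S (sparsity_schedule S0 ST F t0 T n) \<eta>
          (\<lambda>k t i x. G k x (\<xi> k t i \<omega>)) (\<lambda>t. w t \<omega>) (\<lambda>t. m t \<omega>) (\<lambda>k t i. u k t i \<omega>)"
    \<comment> \<open>the optimal parameter of sparsity ST; the final sparsity is reached, which the purging mask
        guarantees by itself for the global variant if the last round is a pruning round\<close>
    and w_opt: "optimal_of_sparsity f ST w_opt"
    and reached: "\<not> (variant = Sparsify_Global \<and> F dvd T) \<Longrightarrow>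
        AE \<omega> in M. sparsity (w (Suc T) \<omega>) \<ge> ST"
  shows "(\<integral>\<omega>. (1 / real T) * (\<Sum>t=1..T. (norm (m t \<omega> * gradient f (w t \<omega>)))\<^sup>2) \<partial>M)
     \<le> 2 * \<eta> * L * ((1 + 4 * L * \<eta> * real S) * \<sigma>\<^sup>2 + (16 * L * \<eta> * (real S)\<^sup>2) * \<epsilon>\<^sup>2)
       + 4 / (real T * \<eta> * real S) * (\<integral>\<omega>. f (w 1 \<omega>) - f w_opt \<partial>M)
       + 4 / (real T * \<eta> * real S) *
           (\<Sum>t=1..T. L\<^sub>p * (\<integral>\<omega>. norm (w (t + 1) \<omega> - w_bar (t + 1) \<omega>) \<partial>M))"
proof -
  let ?s = "sparsity_schedule S0 ST F t0 T n"
  interpret fedsparsify M f_loc f D G \<xi> w m u L L\<^sub>p \<sigma> \<epsilon> \<eta> T S ?s variant I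
    unfolding fedsparsify_def fedsparsify_axioms_def
    using prob f_def constants(1) differentiable smooth lipschitz sample_dist oracle_measurable
      unbiased variance deviation samples indep init init_indep local_steps step_size run
    by (simp add: I_def)
  have T: "T > 0"
    using schedule by simp
  have "AE \<omega> in M. ST \<le> sparsity (w (Suc T) \<omega>)"
  proof (cases "variant = Sparsify_Global \<and> F dvd T")
    case True
    then obtain q where "T = F * q"
      by blast
    then have "real F * of_int \<lfloor>real T / real F\<rfloor> = real T"
      using schedule(1) by simp
    \<comment> \<open>As F divides T, the floor loses nothing, and as t0 < T, the quotient in the
      schedule is 1. The base of the power is then 0.\<close>
    then have "?s T = ST"
      using schedule by (simp add: sparsity_schedule_def)
    moreover have "ST \<le> 1"
      using w_opt has_sparsity_le_1 by (auto simp: optimal_of_sparsity_def)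
    ultimately show ?thesis
      using final_sparsity[OF T] True by auto
  qed (use reached in auto)
  then have "AE \<omega> in M. f w_opt \<le> f (w (Suc T) \<omega>)"
    by eventually_elim (rule optimal_of_sparsity_le[OF w_opt _ lipschitz])
  from average_gradient_bound[OF T this] show ?thesis
    by (simp add: w_bar_def aggregate_def)
qed

end
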